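(* Let $\varphi:R\to S$ be a ring homomorphism. Then the induction functor $\varphi^{\ast}:=S\otimes_R(-):R\text{-}\mathrm{Mod}\to S\text{-}\mathrm{Mod}$ is h-separable if and only if there is a ring homomorphism $E:S\to R$ such that $E\circ\varphi=\mathrm{Id}_R$.
   Context: A functor $F:\mathcal{B}\to\mathcal{A}$ is h-separable (heavily separable) if there are maps $P_{X,Y}:\mathrm{Hom}_{\mathcal{A}}(FX,FY)\to\mathrm{Hom}_{\mathcal{B}}(X,Y)$, natural in $X,Y\in\mathcal{B}$, such that $P_{X,Y}(Ff)=f$ for every $f:X\to Y$ in $\mathcal{B}$, and $P_{X,Z}(f\circ g)=P_{Y,Z}(f)\circ P_{X,Y}(g)$ for all $X,Y,Z\in\mathcal{B}$ and all $g:FX\to FY$, $f:FY\to FZ$ in $\mathcal{A}$. Rings are associative and unital (not necessarily commutative), and ring homomorphisms are unital. $R\text{-}\mathrm{Mod}$ denotes the category of left $R$-modules, and $S$ is an $R$-bimodule via $\varphi$. *)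

theory Defs
  imports "HOL-Algebra.Module" "HOL-Algebra.Free_Abelian_Groups"
begin

section \<open>Categories, functors and heavy separability\<close>

text \<open>Hom-sets are indexed by source and target and need not be disjoint, so composition and the
  action of a functor on morphisms take the objects involved as arguments:
  \<open>Cmp C X Y Z g f\<close> is the composite of \<open>f : X \<rightarrow> Y\<close> followed by \<open>g : Y \<rightarrow> Z\<close>.\<close>

record ('o, 'a) cat =
  Obj :: "'o set"
  Hom :: "'o \<Rightarrow> 'o \<Rightarrow> 'a set"
  Idt :: "'o \<Rightarrow> 'a"
  Cmp :: "'o \<Rightarrow> 'o \<Rightarrow> 'o \<Rightarrow> 'a \<Rightarrow> 'a \<Rightarrow> 'a"

definition category :: "('o, 'a) cat \<Rightarrow> bool" where
  "category C \<longleftrightarrow>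
     (\<forall>X\<in>Obj C. Idt C X \<in> Hom C X X) \<and>
     (\<forall>X\<in>Obj C. \<forall>Y\<in>Obj C. \<forall>Z\<in>Obj C. \<forall>f\<in>Hom C X Y. \<forall>g\<in>Hom C Y Z.
        Cmp C X Y Z g f \<in> Hom C X Z) \<and>
     (\<forall>X\<in>Obj C. \<forall>Y\<in>Obj C. \<forall>f\<in>Hom C X Y.
        Cmp C X X Y f (Idt C X) = f \<and> Cmp C X Y Y (Idt C Y) f = f) \<and>
     (\<forall>W\<in>Obj C. \<forall>X\<in>Obj C. \<forall>Y\<in>Obj C. \<forall>Z\<in>Obj C.
        \<forall>f\<in>Hom C W X. \<forall>g\<in>Hom C X Y. \<forall>h\<in>Hom C Y Z.
        Cmp C W Y Z h (Cmp C W X Y g f) = Cmp C W X Z (Cmp C X Y Z h g) f)"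

record ('o, 'a, 'p, 'b) funct =
  fob :: "'o \<Rightarrow> 'p"
  fmap :: "'o \<Rightarrow> 'o \<Rightarrow> 'a \<Rightarrow> 'b"

definition is_functor :: "('o, 'a) cat \<Rightarrow> ('p, 'b) cat \<Rightarrow> ('o, 'a, 'p, 'b) funct \<Rightarrow> bool" where
  "is_functor B A F \<longleftrightarrow>
     category B \<and> category A \<and>
     (\<forall>X\<in>Obj B. fob F X \<in> Obj A) \<and>
     (\<forall>X\<in>Obj B. \<forall>Y\<in>Obj B. \<forall>f\<in>Hom B X Y. fmap F X Y f \<in> Hom A (fob F X) (fob F Y)) \<and>
     (\<forall>X\<in>Obj B. fmap F X X (Idt B X) = Idt A (fob F X)) \<and>
     (\<forall>X\<in>Obj B. \<forall>Y\<in>Obj B. \<forall>Z\<in>Obj B. \<forall>f\<in>Hom B X Y. \<forall>g\<in>Hom B Y Z.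
        fmap F X Z (Cmp B X Y Z g f) =
          Cmp A (fob F X) (fob F Y) (fob F Z) (fmap F Y Z g) (fmap F X Y f))"

definition h_separable :: "('o, 'a) cat \<Rightarrow> ('p, 'b) cat \<Rightarrow> ('o, 'a, 'p, 'b) funct \<Rightarrow> bool" where
  "h_separable B A F \<longleftrightarrow> (\<exists>P :: 'o \<Rightarrow> 'o \<Rightarrow> 'b \<Rightarrow> 'a.
     (\<forall>X\<in>Obj B. \<forall>Y\<in>Obj B. \<forall>h\<in>Hom A (fob F X) (fob F Y). P X Y h \<in> Hom B X Y) \<and>
     (\<forall>X\<in>Obj B. \<forall>Y\<in>Obj B. \<forall>X'\<in>Obj B. \<forall>Y'\<in>Obj B.
        \<forall>u\<in>Hom B X' X. \<forall>v\<in>Hom B Y Y'. \<forall>h\<in>Hom A (fob F X) (fob F Y).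
        P X' Y' (Cmp A (fob F X') (fob F Y) (fob F Y') (fmap F Y Y' v)
                   (Cmp A (fob F X') (fob F X) (fob F Y) h (fmap F X' X u))) =
          Cmp B X' Y Y' v (Cmp B X' X Y (P X Y h) u)) \<and>
     (\<forall>X\<in>Obj B. \<forall>Y\<in>Obj B. \<forall>f\<in>Hom B X Y. P X Y (fmap F X Y f) = f) \<and>
     (\<forall>X\<in>Obj B. \<forall>Y\<in>Obj B. \<forall>Z\<in>Obj B.
        \<forall>g\<in>Hom A (fob F X) (fob F Y). \<forall>f\<in>Hom A (fob F Y) (fob F Z).
        P X Z (Cmp A (fob F X) (fob F Y) (fob F Z) f g) = Cmp B X Y Z (P Y Z f) (P X Y g)))"

section \<open>Left modules\<close>

text \<open>The library's locale \<open>module\<close> demands a commutative ring; its record type is reused.  As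
  there, the fields \<open>mult\<close> and \<open>one\<close> of a module are ignored.\<close>

locale left_module = R?: ring R + M?: abelian_group M for R (structure) and M (structure) +
  assumes smult_closed [simp, intro]:
      "\<lbrakk>a \<in> carrier R; x \<in> carrier M\<rbrakk> \<Longrightarrow> a \<odot>\<^bsub>M\<^esub> x \<in> carrier M"
    and smult_l_distr:
      "\<lbrakk>a \<in> carrier R; b \<in> carrier R; x \<in> carrier M\<rbrakk> \<Longrightarrow>
       (a \<oplus> b) \<odot>\<^bsub>M\<^esub> x = a \<odot>\<^bsub>M\<^esub> x \<oplus>\<^bsub>M\<^esub> b \<odot>\<^bsub>M\<^esub> x"
    and smult_r_distr:
      "\<lbrakk>a \<in> carrier R; x \<in> carrier M; y \<in> carrier M\<rbrakk> \<Longrightarrow>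
       a \<odot>\<^bsub>M\<^esub> (x \<oplus>\<^bsub>M\<^esub> y) = a \<odot>\<^bsub>M\<^esub> x \<oplus>\<^bsub>M\<^esub> a \<odot>\<^bsub>M\<^esub> y"
    and smult_assoc1:
      "\<lbrakk>a \<in> carrier R; b \<in> carrier R; x \<in> carrier M\<rbrakk> \<Longrightarrow>
       (a \<otimes> b) \<odot>\<^bsub>M\<^esub> x = a \<odot>\<^bsub>M\<^esub> (b \<odot>\<^bsub>M\<^esub> x)"
    and smult_one [simp]:
      "x \<in> carrier M \<Longrightarrow> \<one> \<odot>\<^bsub>M\<^esub> x = x"

text \<open>Homomorphisms are extensional (\<open>undefined\<close> off the carrier), so that equality in the hom-set
  is equality of maps on the carrier.\<close>

definition mod_hom :: "'r ring \<Rightarrow> ('r, 'm) module \<Rightarrow> ('r, 'n) module \<Rightarrow> ('m \<Rightarrow> 'n) set" where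
  "mod_hom R M N = {f \<in> carrier M \<rightarrow>\<^sub>E carrier N.
     (\<forall>x\<in>carrier M. \<forall>y\<in>carrier M. f (x \<oplus>\<^bsub>M\<^esub> y) = f x \<oplus>\<^bsub>N\<^esub> f y) \<and>
     (\<forall>a\<in>carrier R. \<forall>x\<in>carrier M. f (a \<odot>\<^bsub>M\<^esub> x) = a \<odot>\<^bsub>N\<^esub> f x)}"

text \<open>The category \<open>R\<close>-Mod of all left modules whose carriers are sets of elements of type \<open>'m\<close>: a
  type plays the role of the universe.  Statements about \<open>left_Mod R\<close> are polymorphic in \<open>'m\<close> and
  have to assume that \<open>'m\<close> is infinite and has room for \<open>R\<close>, so that \<open>R\<close> and its finite powers are
  among the objects up to isomorphism.\<close>

definition left_Mod :: "'r ring \<Rightarrow> (('r, 'm) module, 'm \<Rightarrow> 'm) cat" where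
  "left_Mod R = \<lparr>Obj = {M. left_module R M},
     Hom = mod_hom R,
     Idt = (\<lambda>M. \<lambda>x\<in>carrier M. x),
     Cmp = (\<lambda>X Y Z g f. compose (carrier X) g f)\<rparr>"

section \<open>The induction functor\<close>

text \<open>\<open>S \<otimes>\<^sub>R M\<close>, with \<open>S\<close> a right \<open>R\<close>-module by \<open>s \<cdot> r = s \<phi>(r)\<close>, is the quotient of the free abelian
  group on \<open>S \<times> M\<close> by the subgroup generated by the biadditivity and balancing relators.\<close>

abbreviation tensor_free :: "'s ring \<Rightarrow> ('r, 'm) module \<Rightarrow> (('s \<times> 'm) \<Rightarrow>\<^sub>0 int) monoid" where
  "tensor_free S M \<equiv> free_Abelian_group (carrier S \<times> carrier M)"

definition tensor_relators ::
    "'r ring \<Rightarrow> 's ring \<Rightarrow> ('r \<Rightarrow> 's) \<Rightarrow> ('r, 'm) module \<Rightarrow> (('s \<times> 'm) \<Rightarrow>\<^sub>0 int) set" where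
  "tensor_relators R S \<phi> M =
     {frag_of (s \<oplus>\<^bsub>S\<^esub> t, m) - frag_of (s, m) - frag_of (t, m) | s t m.
        s \<in> carrier S \<and> t \<in> carrier S \<and> m \<in> carrier M} \<union>
     {frag_of (s, m \<oplus>\<^bsub>M\<^esub> n) - frag_of (s, m) - frag_of (s, n) | s m n.
        s \<in> carrier S \<and> m \<in> carrier M \<and> n \<in> carrier M} \<union>
     {frag_of (s \<otimes>\<^bsub>S\<^esub> \<phi> r, m) - frag_of (s, r \<odot>\<^bsub>M\<^esub> m) | s r m.
        s \<in> carrier S \<and> r \<in> carrier R \<and> m \<in> carrier M}"

definition tensor_kernel ::
    "'r ring \<Rightarrow> 's ring \<Rightarrow> ('r \<Rightarrow> 's) \<Rightarrow> ('r, 'm) module \<Rightarrow> (('s \<times> 'm) \<Rightarrow>\<^sub>0 int) set" where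
  "tensor_kernel R S \<phi> M = generate (tensor_free S M) (tensor_relators R S \<phi> M)"

text \<open>The map of quotients induced by a group homomorphism \<open>\<theta>\<close> into \<open>G\<close> sending the subgroup being
  factored out into \<open>H\<close>.  All cosets in the union below are then equal.\<close>

definition coset_map :: "('b, 'x) monoid_scheme \<Rightarrow> 'b set \<Rightarrow> ('a \<Rightarrow> 'b) \<Rightarrow> 'a set \<Rightarrow> 'b set" where
  "coset_map G H \<theta> C = (\<Union>c\<in>C. H #>\<^bsub>G\<^esub> \<theta> c)"

definition tensor ::
    "'r ring \<Rightarrow> 's ring \<Rightarrow> ('r \<Rightarrow> 's) \<Rightarrow> ('r, 'm) module \<Rightarrow> ('s, (('s \<times> 'm) \<Rightarrow>\<^sub>0 int) set) module"
where
  "tensor R S \<phi> M =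
    (let G = tensor_free S M; H = tensor_kernel R S \<phi> M in
     \<lparr>carrier = carrier (G Mod H), monoid.mult = undefined, monoid.one = undefined,
      ring.zero = \<one>\<^bsub>G Mod H\<^esub>, ring.add = (\<otimes>\<^bsub>G Mod H\<^esub>),
      smult = (\<lambda>s. coset_map G H (frag_extend (\<lambda>(t, m). frag_of (s \<otimes>\<^bsub>S\<^esub> t, m))))\<rparr>)"

definition tensor_map ::
    "'r ring \<Rightarrow> 's ring \<Rightarrow> ('r \<Rightarrow> 's) \<Rightarrow> ('r, 'm) module \<Rightarrow> ('r, 'n) module \<Rightarrow> ('m \<Rightarrow> 'n) \<Rightarrow>
     (('s \<times> 'm) \<Rightarrow>\<^sub>0 int) set \<Rightarrow> (('s \<times> 'n) \<Rightarrow>\<^sub>0 int) set" where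
  "tensor_map R S \<phi> M N f =
     (\<lambda>C\<in>carrier (tensor R S \<phi> M).
        coset_map (tensor_free S N) (tensor_kernel R S \<phi> N)
          (frag_extend (\<lambda>(s, m). frag_of (s, f m))) C)"

text \<open>The carrier of \<open>S \<otimes>\<^sub>R M\<close> has a different type from that of \<open>M\<close>, so the target \<open>S\<close>-Mod lives in
  the universe of that type.\<close>

definition induction_functor ::
    "'r ring \<Rightarrow> 's ring \<Rightarrow> ('r \<Rightarrow> 's) \<Rightarrow>
     (('r, 'm) module, 'm \<Rightarrow> 'm,
      ('s, (('s \<times> 'm) \<Rightarrow>\<^sub>0 int) set) module,
      (('s \<times> 'm) \<Rightarrow>\<^sub>0 int) set \<Rightarrow> (('s \<times> 'm) \<Rightarrow>\<^sub>0 int) set) funct" where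
  "induction_functor R S \<phi> = \<lparr>fob = tensor R S \<phi>, fmap = tensor_map R S \<phi>\<rparr>"

section \<open>Functoriality of induction\<close>

lemma category_left_Mod: "category (left_Mod R :: (('r, 'm) module, 'm \<Rightarrow> 'm) cat)"
proof -
  have smult_cl: "a \<odot>\<^bsub>M\<^esub> x \<in> carrier M" if "left_module R M" "a \<in> carrier R" "x \<in> carrier M"
    for M :: "('r,'m) module" and a x
    using that by (rule left_module.smult_closed)
  have add_cl: "x \<oplus>\<^bsub>M\<^esub> y \<in> carrier M" if "left_module R M" "x \<in> carrier M" "y \<in> carrier M"
    for M :: "('r,'m) module" and x y
    using that by (meson abelian_groupE(1) left_module.axioms(2))
  show ?thesis
    unfolding category_def left_Mod_def mod_hom_def
    by (auto simp: compose_def fun_eq_iff PiE_iff extensional_def smult_cl add_cl)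
qed

lemmas free_Abelian_induct = free_Abelian_group_induct[consumes 1, case_names zero diff one]

lemma id_mod_hom:
  assumes "left_module R X" shows "(\<lambda>x\<in>carrier X. x) \<in> mod_hom R X X"
  using left_module.smult_closed[OF assms] abelian_groupE(1)[OF left_module.axioms(2)[OF assms]]
  unfolding mod_hom_def by auto

lemma compose_mod_hom:
  assumes "left_module R X" "left_module R Y" "left_module R Z" "f \<in> mod_hom R X Y" "g \<in> mod_hom R Y Z"
  shows "compose (carrier X) g f \<in> mod_hom R X Z"
  using assms left_module.smult_closed[OF assms(1)]
    abelian_groupE(1)[OF left_module.axioms(2)[OF assms(1)]]
  unfolding mod_hom_def by (auto simp: compose_def PiE_iff extensional_def)

lemma coset_map_rcos:
  assumes "group G" "subgroup H G" "group G'" "subgroup H' G'"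
    and \<theta>: "\<theta> \<in> hom G G'" and H: "\<And>h. h \<in> H \<Longrightarrow> \<theta> h \<in> H'" and c: "c \<in> carrier G"
  shows "coset_map G' H' \<theta> (H #>\<^bsub>G\<^esub> c) = H' #>\<^bsub>G'\<^esub> \<theta> c"
proof -
  interpret G: group G by fact
  interpret G': group G' by fact
  interpret H: subgroup H G by fact
  interpret H': subgroup H' G' by fact
  have \<theta>c: "\<theta> c \<in> carrier G'" using \<theta> c by (auto simp: hom_def)
  have "H' #>\<^bsub>G'\<^esub> \<theta> x = H' #>\<^bsub>G'\<^esub> \<theta> c" if "x \<in> H #>\<^bsub>G\<^esub> c" for x
  proof -
    obtain h where h: "h \<in> H" "x = h \<otimes>\<^bsub>G\<^esub> c" using \<open>x \<in> H #>\<^bsub>G\<^esub> c\<close> unfolding r_coset_def by blast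
    then have "\<theta> x = \<theta> h \<otimes>\<^bsub>G'\<^esub> \<theta> c" using \<theta> c by (auto simp: hom_def)
    with H[OF h(1)] \<theta>c have "\<theta> x \<in> H' #>\<^bsub>G'\<^esub> \<theta> c" by (auto simp: r_coset_def)
    then show ?thesis using \<theta>c
      by (metis G'.repr_independence assms(4))
  qed
  moreover have "H #>\<^bsub>G\<^esub> c \<noteq> {}" using subgroup.one_closed[OF assms(2)] unfolding r_coset_def by blast
  ultimately show ?thesis unfolding coset_map_def by auto
qed

lemma frag_extend_hom_free:
  assumes "\<And>x. x \<in> A \<Longrightarrow> g x \<in> B"
  shows "frag_extend (\<lambda>x. frag_of (g x)) \<in> hom (free_Abelian_group A) (free_Abelian_group B)"
  using assms keys_frag_extend[of "\<lambda>x. frag_of (g x)"]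
  by (fastforce simp: hom_def frag_extend_add keys_frag_of)

lemma frag_extend_generate:
  assumes h: "\<theta> \<in> hom (free_Abelian_group A) (free_Abelian_group B)"
    and rel: "K \<subseteq> carrier (free_Abelian_group A)"
    and im: "\<And>x. x \<in> K \<Longrightarrow> \<theta> x \<in> L" and x: "x \<in> generate (free_Abelian_group A) K"
  shows "\<theta> x \<in> generate (free_Abelian_group B) L"
proof -
  interpret group_hom "free_Abelian_group A" "free_Abelian_group B" \<theta>
    using h by (simp add: group_hom_def group_hom_axioms_def)
  have "\<theta> x \<in> generate (free_Abelian_group B) (\<theta> ` K)" using generate_img[OF rel] x by blast
  moreover have "\<theta> ` K \<subseteq> L" using im by auto
  ultimately show ?thesis using H.mono_generate by blast
qed

context
  fixes R :: "'r ring" and S :: "'s ring" and \<phi> :: "'r \<Rightarrow> 's"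
  assumes S: "ring S" and \<phi>: "\<phi> \<in> ring_hom R S"
begin

interpretation S: ring S by (rule S)

lemma phi_closed: "r \<in> carrier R \<Longrightarrow> \<phi> r \<in> carrier S"
  using \<phi> by (rule ring_hom_closed)

lemma tensor_relators_carrier:
  assumes "left_module R M"
  shows "tensor_relators R S \<phi> M \<subseteq> carrier (tensor_free S M)"
proof -
  interpret left_module R M by fact
  show ?thesis unfolding tensor_relators_def
    by (fastforce simp: keys_frag_of phi_closed dest!: subsetD[OF keys_diff])
qed

lemma tensor_kernel_subgroup:
  assumes "left_module R M" shows "subgroup (tensor_kernel R S \<phi> M) (tensor_free S M)"
  unfolding tensor_kernel_def
  by (rule group.generate_is_subgroup[OF group_free_Abelian_group tensor_relators_carrier[OF assms]])

lemma tensor_kernel_normal: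
  assumes "left_module R M" shows "tensor_kernel R S \<phi> M \<lhd> tensor_free S M"
  using tensor_kernel_subgroup[OF assms] comm_group.normal_iff_subgroup[OF abelian_free_Abelian_group]
  by blast

lemma tensor_kernel_minus:
  assumes "left_module R M" "x \<in> tensor_kernel R S \<phi> M" "y \<in> tensor_kernel R S \<phi> M"
  shows "x - y \<in> tensor_kernel R S \<phi> M"
proof -
  interpret subgroup "tensor_kernel R S \<phi> M" "tensor_free S M"
    by (rule tensor_kernel_subgroup[OF assms(1)])
  have "y \<in> carrier (tensor_free S M)" using mem_carrier[OF assms(3)] .
  then have "inv\<^bsub>tensor_free S M\<^esub> y = - y" by simp
  then show ?thesis using m_closed[OF assms(2) m_inv_closed[OF assms(3)]] by simp
qed

lemma tensor_coset_eqI: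
  assumes M: "left_module R M" and y: "y \<in> carrier (tensor_free S M)"
    and "x - y \<in> tensor_kernel R S \<phi> M"
  shows "tensor_kernel R S \<phi> M #>\<^bsub>tensor_free S M\<^esub> x = tensor_kernel R S \<phi> M #>\<^bsub>tensor_free S M\<^esub> y"
proof -
  interpret group "tensor_free S M" by simp
  have "x \<in> tensor_kernel R S \<phi> M #>\<^bsub>tensor_free S M\<^esub> y"
    using assms(3) by (auto simp: r_coset_def intro!: bexI[of _ "x-y"])
  then show ?thesis using repr_independence y tensor_kernel_subgroup[OF M] by blast
qed

lemma tensor_sel:
  "carrier (tensor R S \<phi> M) = (\<lambda>c. tensor_kernel R S \<phi> M #>\<^bsub>tensor_free S M\<^esub> c) ` carrier (tensor_free S M)"
  "ring.zero (tensor R S \<phi> M) = tensor_kernel R S \<phi> M"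
  "ring.add (tensor R S \<phi> M) = set_mult (tensor_free S M)"
  "smult (tensor R S \<phi> M) s = coset_map (tensor_free S M) (tensor_kernel R S \<phi> M) (frag_extend (\<lambda>(t, m). frag_of (s \<otimes>\<^bsub>S\<^esub> t, m)))"
  by (simp_all add: tensor_def carrier_FactGroup Let_def)

definition tensor_act where "tensor_act s = frag_extend (\<lambda>p :: 's \<times> 'm. frag_of (s \<otimes>\<^bsub>S\<^esub> fst p, snd p))"

lemma tensor_act_eq: "frag_extend (\<lambda>(t, m). frag_of (s \<otimes>\<^bsub>S\<^esub> t, m)) = tensor_act s"
  unfolding tensor_act_def by (simp add: case_prod_beta')

lemma tensor_act_hom: "s \<in> carrier S \<Longrightarrow> tensor_act s \<in> hom (tensor_free S M) (tensor_free S M)"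
  unfolding tensor_act_def by (rule frag_extend_hom_free) auto

lemma tensor_smult:
  assumes M: "left_module R M" and s: "s \<in> carrier S" and c: "c \<in> carrier (tensor_free S M)"
  shows "s \<odot>\<^bsub>tensor R S \<phi> M\<^esub> (tensor_kernel R S \<phi> M #>\<^bsub>tensor_free S M\<^esub> c)
    = tensor_kernel R S \<phi> M #>\<^bsub>tensor_free S M\<^esub> tensor_act s c"
proof -
  interpret left_module R M by fact
  have rel: "tensor_act s x \<in> tensor_relators R S \<phi> M" if "x \<in> tensor_relators R S \<phi> M" for x
    using that unfolding tensor_relators_def
  proof (elim UnE CollectE exE conjE, goal_cases)
    case (1 a b m)
    then have "s \<otimes>\<^bsub>S\<^esub> a \<in> carrier S" "s \<otimes>\<^bsub>S\<^esub> b \<in> carrier S" using s by auto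
    moreover have "tensor_act s x = frag_of (s \<otimes>\<^bsub>S\<^esub> a \<oplus>\<^bsub>S\<^esub> s \<otimes>\<^bsub>S\<^esub> b, m) - frag_of (s \<otimes>\<^bsub>S\<^esub> a, m) - frag_of (s \<otimes>\<^bsub>S\<^esub> b, m)"
      using 1 by (simp add: tensor_act_def frag_extend_diff S.r_distr s)
    ultimately show ?case using 1 by blast
  next
    case (2 a m n)
    then have "s \<otimes>\<^bsub>S\<^esub> a \<in> carrier S" using s by auto
    with 2 show ?case by (auto simp: tensor_act_def frag_extend_diff)
  next
    case (3 a r m)
    then have "s \<otimes>\<^bsub>S\<^esub> a \<in> carrier S" "s \<otimes>\<^bsub>S\<^esub> (a \<otimes>\<^bsub>S\<^esub> \<phi> r) = s \<otimes>\<^bsub>S\<^esub> a \<otimes>\<^bsub>S\<^esub> \<phi> r" 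
      using s by (auto simp: S.m_assoc phi_closed)
    with 3 show ?case by (auto simp: tensor_act_def frag_extend_diff)
  qed
  show ?thesis unfolding tensor_sel tensor_act_eq
    by (rule coset_map_rcos)
       (use M c tensor_act_hom[OF s] frag_extend_generate[OF tensor_act_hom[OF s] tensor_relators_carrier[OF M] rel]
         in \<open>auto simp: tensor_kernel_subgroup simp flip: tensor_kernel_def\<close>)
qed

lemma tensor_left_module:
  assumes M: "left_module R M"
  shows "left_module S (tensor R S \<phi> M)"
proof -
  interpret left_module R M by fact
  let ?G = "tensor_free S M" and ?K = "tensor_kernel R S \<phi> M"
  interpret N: normal ?K ?G by (rule tensor_kernel_normal[OF M])
  interpret Q: comm_group "?G Mod ?K"
    by (rule comm_group.abelian_FactGroup[OF abelian_free_Abelian_group tensor_kernel_subgroup[OF M]])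
  have T: "abelian_group (tensor R S \<phi> M)"
  proof (rule abelian_groupI, goal_cases)
    case (6 x)
    then show ?case using Q.Units_l_inv_ex[of x] Q.Units_eq by (auto simp: tensor_def Let_def)
  qed (use Q.m_closed Q.one_closed Q.m_assoc Q.m_comm Q.l_one in \<open>auto simp: tensor_def Let_def\<close>)
  have tensor_act_cl: "tensor_act s c \<in> carrier ?G" if "s \<in> carrier S" "c \<in> carrier ?G" for s c
    using hom_in_carrier[OF tensor_act_hom[OF that(1)] that(2)] .
  have coset_cl: "?K #>\<^bsub>?G\<^esub> c \<in> carrier (tensor R S \<phi> M)" if "c \<in> carrier ?G" for c
    using that by (auto simp: tensor_sel)
  note G = group_free_Abelian_group
  have G_add: "c + d \<in> carrier ?G" if "c \<in> carrier ?G" "d \<in> carrier ?G" for c d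
    using group.is_monoid[OF G, THEN monoid.m_closed, of c _ d] that by fastforce
  have add: "(?K #>\<^bsub>?G\<^esub> c) \<oplus>\<^bsub>tensor R S \<phi> M\<^esub> (?K #>\<^bsub>?G\<^esub> d) = ?K #>\<^bsub>?G\<^esub> (c + d)"
    if "c \<in> carrier ?G" "d \<in> carrier ?G" for c d
    using N.rcos_sum[OF that] by (simp add: tensor_sel)
  have k0: "0 \<in> ?K" using subgroup.one_closed[OF tensor_kernel_subgroup[OF M]] unfolding one_free_Abelian_group .
  note relK = generate.incl[of _ "tensor_relators R S \<phi> M" ?G, folded tensor_kernel_def]
  have "left_module_axioms S (tensor R S \<phi> M)"
  proof (rule left_module_axioms.intro, goal_cases)
    case (1 a x) then show ?case
      by (auto simp only: tensor_sel(1) tensor_smult[OF M] tensor_act_cl)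
  next
    case (2 a b x)
    then obtain c where c: "c \<in> carrier ?G" "x = ?K #>\<^bsub>?G\<^esub> c" unfolding tensor_sel by auto
    have "Poly_Mapping.keys c \<subseteq> carrier S \<times> carrier M" using c by simp
    then have "tensor_act (a \<oplus>\<^bsub>S\<^esub> b) c - (tensor_act a c + tensor_act b c) \<in> ?K"
    proof (induction rule: free_Abelian_induct)
      case zero then show ?case by (simp add: tensor_act_def k0)
    next
      case (diff x y)
      then show ?case using tensor_kernel_minus[OF M diff(3,4)]
        by (simp add: tensor_act_def frag_extend_diff algebra_simps)
    next
      case (one p)
      then show ?case using 2 
        by (intro relK) (auto simp: tensor_act_def tensor_relators_def S.l_distr algebra_simps, metis S.m_closed)
    qed
    then show ?case using 2 c
      by (simp only: tensor_smult[OF M] S.add.m_closed add tensor_act_cl G_add tensor_coset_eqI[OF M])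
  next
    case (3 a x y)
    then obtain c d where c: "c \<in> carrier ?G" "x = ?K #>\<^bsub>?G\<^esub> c" "d \<in> carrier ?G" "y = ?K #>\<^bsub>?G\<^esub> d"
      unfolding tensor_sel by auto
    have "tensor_act a (c + d) = tensor_act a c + tensor_act a d" by (simp add: tensor_act_def frag_extend_add)
    then show ?case using 3 c by (simp only: tensor_smult[OF M] add tensor_act_cl G_add)
  next
    case (4 a b x)
    then obtain c where c: "c \<in> carrier ?G" "x = ?K #>\<^bsub>?G\<^esub> c" unfolding tensor_sel by auto
    have "Poly_Mapping.keys c \<subseteq> carrier S \<times> carrier M" using c by simp
    then have "tensor_act (a \<otimes>\<^bsub>S\<^esub> b) c = tensor_act a (tensor_act b c)"
      by (induction c rule: free_Abelian_induct)
         (use 4 in \<open>auto simp: tensor_act_def frag_extend_diff S.m_assoc\<close>)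
    then show ?case using 4 c
      by (simp only: tensor_smult[OF M] S.m_closed tensor_act_cl)
  next
    case (5 x)
    then obtain c where c: "c \<in> carrier ?G" "x = ?K #>\<^bsub>?G\<^esub> c" unfolding tensor_sel by auto
    have "Poly_Mapping.keys c \<subseteq> carrier S \<times> carrier M" using c by simp
    then have "tensor_act \<one>\<^bsub>S\<^esub> c = c"
      by (induction c rule: free_Abelian_induct) (auto simp: tensor_act_def frag_extend_diff)
    then show ?case using c by (simp only: tensor_smult[OF M] S.one_closed)
  qed
  with T S show ?thesis by (simp add: left_module_def)
qed

definition tensor_ind where "tensor_ind f = frag_extend (\<lambda>p :: 's \<times> 'm. frag_of (fst p, f (snd p)))"

lemma tensor_ind_eq: "frag_extend (\<lambda>(t, m). frag_of (t, f m)) = tensor_ind f"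
  unfolding tensor_ind_def by (simp add: case_prod_beta')

lemma tensor_ind_hom: "f \<in> mod_hom R M N \<Longrightarrow> tensor_ind f \<in> hom (tensor_free S M) (tensor_free S N)"
  unfolding tensor_ind_def by (rule frag_extend_hom_free) (auto simp: mod_hom_def)

lemma tensor_map_coset:
  assumes M: "left_module R M" and N: "left_module R N" and f: "f \<in> mod_hom R M N"
    and c: "c \<in> carrier (tensor_free S M)"
  shows "tensor_map R S \<phi> M N f (tensor_kernel R S \<phi> M #>\<^bsub>tensor_free S M\<^esub> c)
    = tensor_kernel R S \<phi> N #>\<^bsub>tensor_free S N\<^esub> tensor_ind f c"
proof -
  interpret M: left_module R M by fact
  have rel: "tensor_ind f x \<in> tensor_relators R S \<phi> N" if "x \<in> tensor_relators R S \<phi> M" for x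
    using that unfolding tensor_relators_def
  proof (elim UnE CollectE exE conjE, goal_cases)
    case (1 a b m)
    with f have "f m \<in> carrier N" by (auto simp: mod_hom_def)
    with 1 show ?case by (auto simp: tensor_ind_def frag_extend_diff)
  next
    case (2 a m n)
    with f have "f m \<in> carrier N" "f n \<in> carrier N" "f (m \<oplus>\<^bsub>M\<^esub> n) = f m \<oplus>\<^bsub>N\<^esub> f n"
      by (auto simp: mod_hom_def)
    with 2 show ?case by (auto simp: tensor_ind_def frag_extend_diff)
  next
    case (3 a r m)
    with f have "f m \<in> carrier N" "f (r \<odot>\<^bsub>M\<^esub> m) = r \<odot>\<^bsub>N\<^esub> f m"
      by (auto simp: mod_hom_def)
    with 3 show ?case by (auto simp: tensor_ind_def frag_extend_diff)
  qed
  have "coset_map (tensor_free S N) (tensor_kernel R S \<phi> N) (tensor_ind f)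
      (tensor_kernel R S \<phi> M #>\<^bsub>tensor_free S M\<^esub> c) = tensor_kernel R S \<phi> N #>\<^bsub>tensor_free S N\<^esub> tensor_ind f c"
    by (rule coset_map_rcos)
       (use M N c tensor_ind_hom[OF f] frag_extend_generate[OF tensor_ind_hom[OF f] tensor_relators_carrier[OF M] rel]
         in \<open>auto simp: tensor_kernel_subgroup simp flip: tensor_kernel_def\<close>)
  then show ?thesis using c by (auto simp: tensor_map_def tensor_ind_eq tensor_sel)
qed

lemma tensor_map_hom:
  assumes M: "left_module R M" and N: "left_module R N" and f: "f \<in> mod_hom R M N"
  shows "tensor_map R S \<phi> M N f \<in> mod_hom S (tensor R S \<phi> M) (tensor R S \<phi> N)"
proof -
  let ?G = "tensor_free S M" and ?K = "tensor_kernel R S \<phi> M"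
  let ?G' = "tensor_free S N" and ?K' = "tensor_kernel R S \<phi> N"
  note tm = tensor_map_coset[OF M N f]
  have tensor_ind_cl: "tensor_ind f c \<in> carrier ?G'" if "c \<in> carrier ?G" for c
    using hom_in_carrier[OF tensor_ind_hom[OF f] that] .
  have tensor_act_cl: "tensor_act s c \<in> carrier ?G" if "s \<in> carrier S" "c \<in> carrier ?G" for s c
    using hom_in_carrier[OF tensor_act_hom[OF that(1)] that(2)] .
  have G_add: "c + d \<in> carrier ?G" if "c \<in> carrier ?G" "d \<in> carrier ?G" for c d
    using group.is_monoid[OF group_free_Abelian_group, THEN monoid.m_closed, of c _ d] that by fastforce
  note add = normal.rcos_sum[OF tensor_kernel_normal[OF M], unfolded mult_free_Abelian_group]
   and add' = normal.rcos_sum[OF tensor_kernel_normal[OF N], unfolded mult_free_Abelian_group]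
  have comm: "tensor_ind f (tensor_act a c) = tensor_act a (tensor_ind f c)" if "Poly_Mapping.keys c \<subseteq> carrier S \<times> carrier M" for a c
    using that by (induction c rule: free_Abelian_induct) (auto simp: tensor_act_def tensor_ind_def frag_extend_diff)
  show ?thesis
    unfolding mod_hom_def
  proof (intro CollectI conjI ballI)
    show "tensor_map R S \<phi> M N f \<in> carrier (tensor R S \<phi> M) \<rightarrow>\<^sub>E carrier (tensor R S \<phi> N)"
      proof (rule PiE_I)
      fix x assume "x \<in> carrier (tensor R S \<phi> M)"
      then show "tensor_map R S \<phi> M N f x \<in> carrier (tensor R S \<phi> N)"
        by (auto simp only: tensor_sel tm tensor_ind_cl)
    qed (simp add: tensor_map_def)
  next
    fix x y assume "x \<in> carrier (tensor R S \<phi> M)" "y \<in> carrier (tensor R S \<phi> M)"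
    then obtain c d where c: "c \<in> carrier ?G" "x = ?K #>\<^bsub>?G\<^esub> c" "d \<in> carrier ?G" "y = ?K #>\<^bsub>?G\<^esub> d"
      unfolding tensor_sel by auto
    then show "tensor_map R S \<phi> M N f (x \<oplus>\<^bsub>tensor R S \<phi> M\<^esub> y) =
       tensor_map R S \<phi> M N f x \<oplus>\<^bsub>tensor R S \<phi> N\<^esub> tensor_map R S \<phi> M N f y"
      by (simp only: tensor_sel add add' tm tensor_ind_cl G_add) (simp add: tensor_ind_def frag_extend_add)
  next
    fix a x assume a: "a \<in> carrier S" "x \<in> carrier (tensor R S \<phi> M)"
    then obtain c where c: "c \<in> carrier ?G" "x = ?K #>\<^bsub>?G\<^esub> c"
      unfolding tensor_sel by auto
    then have "tensor_ind f (tensor_act a c) = tensor_act a (tensor_ind f c)" using comm by simp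
    with a c show "tensor_map R S \<phi> M N f (a \<odot>\<^bsub>tensor R S \<phi> M\<^esub> x) =
       a \<odot>\<^bsub>tensor R S \<phi> N\<^esub> tensor_map R S \<phi> M N f x"
      by (simp only: tensor_smult[OF M] tensor_smult[OF N] tm tensor_ind_cl tensor_act_cl)
  qed
qed

lemma is_functor_induction:
  "is_functor (left_Mod R) (left_Mod S) (induction_functor R S \<phi>)"
proof -
  have 1: "tensor_map R S \<phi> M M (\<lambda>x\<in>carrier M. x) = (\<lambda>x\<in>carrier (tensor R S \<phi> M). x)"
    if M: "left_module R M" for M :: "('r,'m) module"
  proof (rule extensionalityI)
    fix x assume "x \<in> carrier (tensor R S \<phi> M)"
    then obtain c where c: "c \<in> carrier (tensor_free S M)" "x = tensor_kernel R S \<phi> M #>\<^bsub>tensor_free S M\<^esub> c"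
      unfolding tensor_sel by auto
    have id: "(\<lambda>x\<in>carrier M. x) \<in> mod_hom R M M"
      by (rule id_mod_hom[OF M])
    have "Poly_Mapping.keys c \<subseteq> carrier S \<times> carrier M" using c by simp
    then have "tensor_ind (\<lambda>x\<in>carrier M. x) c = c"
      by (induction c rule: free_Abelian_induct) (auto simp: tensor_ind_def frag_extend_diff)
    then show "tensor_map R S \<phi> M M (\<lambda>x\<in>carrier M. x) x = (\<lambda>x\<in>carrier (tensor R S \<phi> M). x) x"
      using c tensor_map_coset[OF M M id c(1)] by (auto simp: tensor_sel)
  qed (auto simp: tensor_map_def)
  have 2: "tensor_map R S \<phi> X Z (compose (carrier X) g f) =
       compose (carrier (tensor R S \<phi> X)) (tensor_map R S \<phi> Y Z g) (tensor_map R S \<phi> X Y f)"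
    if X: "left_module R X" and Y: "left_module R Y" and Z: "left_module R Z"
      and f: "f \<in> mod_hom R X Y" and g: "g \<in> mod_hom R Y Z" for X Y Z :: "('r,'m) module" and f g
  proof (rule extensionalityI)
    fix x assume x: "x \<in> carrier (tensor R S \<phi> X)"
    then obtain c where c: "c \<in> carrier (tensor_free S X)" "x = tensor_kernel R S \<phi> X #>\<^bsub>tensor_free S X\<^esub> c"
      unfolding tensor_sel by auto
    have gf: "compose (carrier X) g f \<in> mod_hom R X Z"
      using compose_mod_hom[OF X Y Z f g] .
    have fc: "tensor_ind f c \<in> carrier (tensor_free S Y)" using hom_in_carrier[OF tensor_ind_hom[OF f] c(1)] .
    have "Poly_Mapping.keys c \<subseteq> carrier S \<times> carrier X" using c by simp
    then have "tensor_ind (compose (carrier X) g f) c = tensor_ind g (tensor_ind f c)"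
      by (induction c rule: free_Abelian_induct) (auto simp: tensor_ind_def frag_extend_diff compose_def)
    then show "tensor_map R S \<phi> X Z (compose (carrier X) g f) x =
       compose (carrier (tensor R S \<phi> X)) (tensor_map R S \<phi> Y Z g) (tensor_map R S \<phi> X Y f) x"
      using x c(2) tensor_map_coset[OF X Z gf c(1)] tensor_map_coset[OF X Y f c(1)]
        tensor_map_coset[OF Y Z g fc] by (simp add: compose_def)
  qed (auto simp: tensor_map_def compose_def)
  show ?thesis
    unfolding is_functor_def using 1 2
    by (auto simp: category_left_Mod induction_functor_def) 
       (auto simp: left_Mod_def tensor_left_module tensor_map_hom)
qed

end

end

theory Submission
  imports Defs
begin

text \<open>Write \<open>F\<close> for extension of scalars \<open>M \<mapsto> S \<otimes>\<^sub>R M\<close>.  The whole argument uses \<open>F\<close> only through its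
  universal property: an \<open>S\<close>-linear map \<open>F M \<rightarrow> N\<close> is the same as an \<open>R\<close>-linear map from \<open>M\<close> to \<open>N\<close>
  regarded as an \<open>R\<close>-module along \<open>\<phi>\<close>, the correspondence being evaluation at \<open>1 \<otimes> m\<close>
  (\<open>ext_universal\<close>, \<open>ext_hom_eqI\<close>).

  Suppose \<open>E\<close> is a ring homomorphism with \<open>E \<circ> \<phi> = id\<close>.  Every \<open>R\<close>-module \<open>M\<close> becomes an \<open>S\<close>-module along
  \<open>E\<close>, and \<open>\<epsilon>(s \<otimes> m) = E(s) m\<close> is an \<open>S\<close>-linear retraction of the unit \<open>\<eta>(m) = 1 \<otimes> m\<close>.  The maps
  \<open>P(h) = \<epsilon> \<circ> h \<circ> \<eta>\<close> satisfy \<open>P(h) \<circ> \<epsilon> = \<epsilon> \<circ> h\<close>, as both sides are \<open>S\<close>-linear and agree on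
  \<open>1 \<otimes> m\<close>.  This is the point at which the multiplicativity of \<open>E\<close> enters, and it implies that \<open>P\<close> respects
  composition, which is what distinguishes heavy separability from separability.

  Conversely, suppose \<open>P\<close> witnesses heavy separability.  For a free module \<open>M\<close> of rank one, the
  endomorphism rings of \<open>F M\<close> and \<open>M\<close> are the opposite rings of \<open>S\<close> and \<open>R\<close>, so \<open>P\<close> induces a
  multiplicative map \<open>E\<close> from \<open>S\<close> to \<open>R\<close> with \<open>E \<circ> \<phi> = id\<close>.  Heavy separability makes no mention of
  addition; that \<open>E\<close> is additive comes from naturality with respect to the projections of the biproduct
  \<open>M \<oplus> M\<close> and their sum (\<open>natural_imp_additive\<close>).  The free module and the biproduct have to be found
  among the modules carried by subsets of a given type, which is where its infinity and the embedding
  of \<open>R\<close> into it are used.\<close>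

section \<open>Module homomorphisms\<close>

lemma mod_hom_closed: "f \<in> mod_hom R M N \<Longrightarrow> x \<in> carrier M \<Longrightarrow> f x \<in> carrier N"
  by (auto simp: mod_hom_def)

lemma mod_hom_add:
  "f \<in> mod_hom R M N \<Longrightarrow> x \<in> carrier M \<Longrightarrow> y \<in> carrier M \<Longrightarrow>
   f (x \<oplus>\<^bsub>M\<^esub> y) = f x \<oplus>\<^bsub>N\<^esub> f y"
  by (auto simp: mod_hom_def)

lemma mod_hom_smult:
  "f \<in> mod_hom R M N \<Longrightarrow> a \<in> carrier R \<Longrightarrow> x \<in> carrier M \<Longrightarrow>
   f (a \<odot>\<^bsub>M\<^esub> x) = a \<odot>\<^bsub>N\<^esub> f x"
  by (auto simp: mod_hom_def)

lemma mod_homI: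
  assumes "\<And>x. x \<in> carrier M \<Longrightarrow> f x \<in> carrier N"
    and "f \<in> extensional (carrier M)"
    and "\<And>x y. x \<in> carrier M \<Longrightarrow> y \<in> carrier M \<Longrightarrow> f (x \<oplus>\<^bsub>M\<^esub> y) = f x \<oplus>\<^bsub>N\<^esub> f y"
    and "\<And>a x. a \<in> carrier R \<Longrightarrow> x \<in> carrier M \<Longrightarrow> f (a \<odot>\<^bsub>M\<^esub> x) = a \<odot>\<^bsub>N\<^esub> f x"
  shows "f \<in> mod_hom R M N"
  using assms by (auto simp: mod_hom_def PiE_iff)

lemma mod_hom_eqI:
  assumes "f \<in> mod_hom R M N" and "g \<in> mod_hom R M N"
    and "\<And>x. x \<in> carrier M \<Longrightarrow> f x = g x"
  shows "f = g"
  using assms by (auto simp: mod_hom_def PiE_iff intro: extensionalityI)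

lemma left_module_add_closed:
  "left_module R M \<Longrightarrow> x \<in> carrier M \<Longrightarrow> y \<in> carrier M \<Longrightarrow> x \<oplus>\<^bsub>M\<^esub> y \<in> carrier M"
  by (rule abelian_groupE(1)[OF left_module.axioms(2)])

lemma left_module_zero_closed: "left_module R M \<Longrightarrow> \<zero>\<^bsub>M\<^esub> \<in> carrier M"
  by (rule abelian_groupE(2)[OF left_module.axioms(2)])

lemma left_module_smult_zero:
  assumes "left_module R M" and "a \<in> carrier R"
  shows "a \<odot>\<^bsub>M\<^esub> \<zero>\<^bsub>M\<^esub> = \<zero>\<^bsub>M\<^esub>"
proof -
  interpret left_module R M by fact
  have "a \<odot>\<^bsub>M\<^esub> \<zero>\<^bsub>M\<^esub> \<oplus>\<^bsub>M\<^esub> a \<odot>\<^bsub>M\<^esub> \<zero>\<^bsub>M\<^esub> = a \<odot>\<^bsub>M\<^esub> \<zero>\<^bsub>M\<^esub>"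
    using smult_r_distr[OF assms(2), of "\<zero>\<^bsub>M\<^esub>" "\<zero>\<^bsub>M\<^esub>"] by simp
  then show ?thesis using assms(2) M.add.l_cancel_one' by (metis M.zero_closed smult_closed)
qed

lemma left_module_smult_minus:
  assumes "left_module R M" and a: "a \<in> carrier R" and x: "x \<in> carrier M" and y: "y \<in> carrier M"
  shows "a \<odot>\<^bsub>M\<^esub> (x \<ominus>\<^bsub>M\<^esub> y) = a \<odot>\<^bsub>M\<^esub> x \<ominus>\<^bsub>M\<^esub> a \<odot>\<^bsub>M\<^esub> y"
proof -
  interpret left_module R M by fact
  have "a \<odot>\<^bsub>M\<^esub> (x \<ominus>\<^bsub>M\<^esub> y) \<oplus>\<^bsub>M\<^esub> a \<odot>\<^bsub>M\<^esub> y = a \<odot>\<^bsub>M\<^esub> x"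
    using smult_r_distr[OF a, of "x \<ominus>\<^bsub>M\<^esub> y" y] x y
    by (simp add: a_minus_def M.add.m_assoc M.l_neg)
  then show ?thesis
    using a x y M.add.inv_solve_right
    by (metis M.minus_closed a_minus_def smult_closed)
qed

lemma mod_hom_zero:
  assumes "left_module R M" and "left_module R N" and f: "f \<in> mod_hom R M N"
  shows "f \<zero>\<^bsub>M\<^esub> = \<zero>\<^bsub>N\<^esub>"
proof -
  interpret M: left_module R M by fact
  interpret N: left_module R N by fact
  have "f \<zero>\<^bsub>M\<^esub> \<oplus>\<^bsub>N\<^esub> f \<zero>\<^bsub>M\<^esub> = f \<zero>\<^bsub>M\<^esub>"
    using mod_hom_add[OF f, of "\<zero>\<^bsub>M\<^esub>" "\<zero>\<^bsub>M\<^esub>"] by simp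
  then show ?thesis using N.add.l_cancel_one' mod_hom_closed[OF f] by (metis M.M.zero_closed)
qed

lemma mod_hom_minus:
  assumes "left_module R M" and "left_module R N" and f: "f \<in> mod_hom R M N"
    and x: "x \<in> carrier M" and y: "y \<in> carrier M"
  shows "f (x \<ominus>\<^bsub>M\<^esub> y) = f x \<ominus>\<^bsub>N\<^esub> f y"
proof -
  interpret M: left_module R M by fact
  interpret N: left_module R N by fact
  have "f (x \<ominus>\<^bsub>M\<^esub> y) \<oplus>\<^bsub>N\<^esub> f y = f x"
    using mod_hom_add[OF f, of "x \<ominus>\<^bsub>M\<^esub> y" y] x y
    by (simp add: a_minus_def M.M.add.m_assoc M.M.l_neg)
  then show ?thesis
    using mod_hom_closed[OF f] x y N.M.add.inv_solve_right
    by (metis M.M.minus_closed a_minus_def)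
qed

definition hom_sum :: "('a, 'm) module \<Rightarrow> ('a, 'n) module \<Rightarrow> ('m \<Rightarrow> 'n) \<Rightarrow> ('m \<Rightarrow> 'n) \<Rightarrow> 'm \<Rightarrow> 'n"
  where "hom_sum M N f g = (\<lambda>x\<in>carrier M. f x \<oplus>\<^bsub>N\<^esub> g x)"

lemma hom_sum_mod_hom:
  assumes M: "left_module R M" and N: "left_module R N"
    and f: "f \<in> mod_hom R M N" and g: "g \<in> mod_hom R M N"
  shows "hom_sum M N f g \<in> mod_hom R M N"
proof -
  interpret M: left_module R M by fact
  interpret N: left_module R N by fact
  note cl = mod_hom_closed[OF f] mod_hom_closed[OF g]
  show ?thesis
    by (rule mod_homI)
      (auto simp: hom_sum_def cl mod_hom_add[OF f] mod_hom_add[OF g] mod_hom_smult[OF f]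
        mod_hom_smult[OF g] N.smult_r_distr N.M.add.m_ac)
qed

lemma zero_mod_hom:
  assumes M: "left_module R M" and N: "left_module R N"
  shows "(\<lambda>x\<in>carrier M. \<zero>\<^bsub>N\<^esub>) \<in> mod_hom R M N"
proof -
  interpret M: left_module R M by fact
  interpret N: left_module R N by fact
  show ?thesis by (rule mod_homI) (auto simp: left_module_smult_zero[OF N])
qed

lemma compose_id_mod_hom: "f \<in> mod_hom R M N \<Longrightarrow> compose (carrier M) f (\<lambda>x\<in>carrier M. x) = f"
  by (auto simp: mod_hom_def compose_def PiE_iff extensional_def fun_eq_iff)

section \<open>Restriction of scalars\<close>

text \<open>The record is built afresh rather than updated because the type of scalars changes.\<close>

definition restrict_scalars :: "('r \<Rightarrow> 's) \<Rightarrow> ('s, 'n) module \<Rightarrow> ('r, 'n) module" where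
  "restrict_scalars \<phi> N =
     \<lparr>carrier = carrier N, monoid.mult = undefined, monoid.one = undefined,
      ring.zero = \<zero>\<^bsub>N\<^esub>, ring.add = (\<oplus>\<^bsub>N\<^esub>), smult = (\<lambda>r. smult N (\<phi> r))\<rparr>"

lemma restrict_scalars_simps [simp]:
  "carrier (restrict_scalars \<phi> N) = carrier N"
  "ring.zero (restrict_scalars \<phi> N) = \<zero>\<^bsub>N\<^esub>"
  "ring.add (restrict_scalars \<phi> N) = (\<oplus>\<^bsub>N\<^esub>)"
  "smult (restrict_scalars \<phi> N) r = smult N (\<phi> r)"
  by (simp_all add: restrict_scalars_def)

lemma left_module_restrict_scalars:
  assumes "ring R" and \<phi>: "\<phi> \<in> ring_hom R S" and "left_module S N"
  shows "left_module R (restrict_scalars \<phi> N)"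
proof -
  interpret N: left_module S N by fact
  have "abelian_group (restrict_scalars \<phi> N)"
    by (rule abelian_groupI) (auto simp: N.M.add.m_ac intro: N.M.l_neg)
  moreover have "left_module_axioms R (restrict_scalars \<phi> N)"
    by unfold_locales
      (use \<phi> in \<open>auto simp: ring_hom_closed ring_hom_add ring_hom_mult ring_hom_one
        N.smult_l_distr N.smult_r_distr N.smult_assoc1\<close>)
  ultimately show ?thesis using \<open>ring R\<close> by (simp add: left_module_def)
qed

lemma mod_hom_restrict_scalars:
  assumes "f \<in> mod_hom R M N" and "E \<in> ring_hom S R"
  shows "f \<in> mod_hom S (restrict_scalars E M) (restrict_scalars E N)"
  using assms by (auto simp: mod_hom_def ring_hom_closed)

section \<open>Free modules of rank one and biproducts inside a universe\<close>

text \<open>The modules \<open>R\<close> and \<open>M \<times> M\<close> have carriers of type \<open>'r\<close> and \<open>'m \<times> 'm\<close>, whereas the objects of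
  the module category have carriers of type \<open>'m\<close>.  An injection of the carrier into \<open>'m\<close> moves
  the structure to an isomorphic module inside that universe.\<close>

definition transport :: "('n \<Rightarrow> 'm) \<Rightarrow> ('r, 'n) module \<Rightarrow> ('r, 'm) module" where
  "transport j M = (let g = inv_into (carrier M) j in
     \<lparr>carrier = j ` carrier M, monoid.mult = undefined, monoid.one = undefined,
      ring.zero = j \<zero>\<^bsub>M\<^esub>, ring.add = (\<lambda>x y. j (g x \<oplus>\<^bsub>M\<^esub> g y)),
      smult = (\<lambda>r x. j (r \<odot>\<^bsub>M\<^esub> g x))\<rparr>)"

lemma transport_simps:
  assumes "inj_on j (carrier M)"
  shows "carrier (transport j M) = j ` carrier M"
    and "\<zero>\<^bsub>transport j M\<^esub> = j \<zero>\<^bsub>M\<^esub>"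
    and "x \<in> carrier M \<Longrightarrow> y \<in> carrier M \<Longrightarrow> j x \<oplus>\<^bsub>transport j M\<^esub> j y = j (x \<oplus>\<^bsub>M\<^esub> y)"
    and "x \<in> carrier M \<Longrightarrow> r \<odot>\<^bsub>transport j M\<^esub> j x = j (r \<odot>\<^bsub>M\<^esub> x)"
  using assms by (simp_all add: transport_def Let_def inv_into_f_f)

lemma left_module_transport:
  assumes "left_module R M" and j: "inj_on j (carrier M)"
  shows "left_module R (transport j M)"
proof -
  interpret M: left_module R M by fact
  note [simp] = transport_simps[OF j]
  have "abelian_group (transport j M)"
  proof (rule abelian_groupI, goal_cases)
    case (6 x)
    then obtain y where "y \<in> carrier M" "x = j y" by auto
    then show ?case by (intro bexI[of _ "j (\<ominus>\<^bsub>M\<^esub> y)"]) (auto simp: M.M.l_neg)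
  qed (auto simp: M.M.add.m_ac)
  moreover have "left_module_axioms R (transport j M)"
    by unfold_locales
      (auto simp: M.smult_l_distr M.smult_r_distr M.smult_assoc1)
  ultimately show ?thesis using M.R.ring_axioms by (simp add: left_module_def)
qed

definition regular_module :: "'r ring \<Rightarrow> ('r, 'r) module" where
  "regular_module R =
     \<lparr>carrier = carrier R, monoid.mult = undefined, monoid.one = undefined,
      ring.zero = \<zero>\<^bsub>R\<^esub>, ring.add = (\<oplus>\<^bsub>R\<^esub>), smult = (\<otimes>\<^bsub>R\<^esub>)\<rparr>"

lemma left_module_regular:
  assumes "ring R"
  shows "left_module R (regular_module R)"
proof -
  interpret ring R by fact
  have "abelian_group (regular_module R)"
    by (rule abelian_groupI) (auto simp: regular_module_def a_ac intro: l_neg)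
  moreover have "left_module_axioms R (regular_module R)"
    by unfold_locales (auto simp: regular_module_def l_distr r_distr m_assoc)
  ultimately show ?thesis using assms by (simp add: left_module_def)
qed

definition module_basis :: "'r ring \<Rightarrow> ('r, 'm) module \<Rightarrow> 'm \<Rightarrow> bool" where
  "module_basis R M e \<longleftrightarrow>
     left_module R M \<and> e \<in> carrier M \<and> bij_betw (\<lambda>r. r \<odot>\<^bsub>M\<^esub> e) (carrier R) (carrier M)"

text \<open>The witness is a copy of \<open>R\<close> as a module over itself, with basis the copy of \<open>1\<close>; the cardinality
  hypothesis provides the injection along which it is copied.\<close>

lemma module_basis_exists:
  fixes R :: "'r ring"
  assumes "ring R" and "carrier R \<lesssim> (UNIV :: 'm set)"
  obtains M :: "('r, 'm) module" and e where "module_basis R M e"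
proof -
  interpret ring R by fact
  obtain j :: "'r \<Rightarrow> 'm" where "inj_on j (carrier R)" using assms(2) by (auto simp: lepoll_def)
  moreover have [simp]: "carrier (regular_module R) = carrier R" "smult (regular_module R) = (\<otimes>\<^bsub>R\<^esub>)"
    by (simp_all add: regular_module_def)
  ultimately have j: "inj_on j (carrier (regular_module R))" by simp
  let ?M = "transport j (regular_module R)"
  note [simp] = transport_simps[OF j]
  have "bij_betw j (carrier R) (carrier ?M)"
    using j by (simp add: bij_betw_def)
  then have "bij_betw (\<lambda>r. r \<odot>\<^bsub>?M\<^esub> j \<one>\<^bsub>R\<^esub>) (carrier R) (carrier ?M)"
    by (rule bij_betw_cong[THEN iffD1, rotated]) simp
  moreover have "j \<one>\<^bsub>R\<^esub> \<in> carrier ?M" by simp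
  ultimately show ?thesis
    using that left_module_transport[OF left_module_regular[OF assms(1)] j]
    unfolding module_basis_def by blast
qed

text \<open>The map sends \<open>r e\<close> to \<open>r n\<close>, which makes sense because the coordinate \<open>r\<close> is unique.\<close>

lemma module_basis_extend:
  assumes M: "module_basis R M e" and N: "left_module R N" and n: "n \<in> carrier N"
  obtains f where "f \<in> mod_hom R M N" and "f e = n"
proof -
  interpret M: left_module R M using M by (simp add: module_basis_def)
  interpret N: left_module R N by fact
  have bij: "bij_betw (\<lambda>r. r \<odot>\<^bsub>M\<^esub> e) (carrier R) (carrier M)" and e: "e \<in> carrier M"
    using M by (auto simp: module_basis_def)
  define c where "c = inv_into (carrier R) (\<lambda>r. r \<odot>\<^bsub>M\<^esub> e)"
  have c [simp]: "c (r \<odot>\<^bsub>M\<^esub> e) = r" if "r \<in> carrier R" for r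
    unfolding c_def by (rule inv_into_f_f[OF bij_betw_imp_inj_on[OF bij] that])
  have ex: "\<exists>r\<in>carrier R. x = r \<odot>\<^bsub>M\<^esub> e" if "x \<in> carrier M" for x
    using bij that by (auto simp: bij_betw_def)
  define f where "f = (\<lambda>x\<in>carrier M. c x \<odot>\<^bsub>N\<^esub> n)"
  have f: "f (r \<odot>\<^bsub>M\<^esub> e) = r \<odot>\<^bsub>N\<^esub> n" if "r \<in> carrier R" for r
    using that e by (simp add: f_def)
  show ?thesis
  proof
    show "f e = n" using f[of "\<one>\<^bsub>R\<^esub>"] e n by simp
    show "f \<in> mod_hom R M N"
    proof (rule mod_homI)
      show "f x \<in> carrier N" if "x \<in> carrier M" for x using ex[OF that] n by (auto simp: f)
      show "f \<in> extensional (carrier M)" by (simp add: f_def)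
      show "f (x \<oplus>\<^bsub>M\<^esub> y) = f x \<oplus>\<^bsub>N\<^esub> f y" if "x \<in> carrier M" "y \<in> carrier M" for x y
        using ex[OF that(1)] ex[OF that(2)] n e
        by (auto simp: f N.smult_l_distr simp flip: M.smult_l_distr)
      show "f (a \<odot>\<^bsub>M\<^esub> x) = a \<odot>\<^bsub>N\<^esub> f x" if "a \<in> carrier R" "x \<in> carrier M" for a x
        using ex[OF that(2)] that(1) n e
        by (auto simp: f N.smult_assoc1 simp flip: M.smult_assoc1)
    qed
  qed
qed

definition double_module :: "('r, 'm) module \<Rightarrow> ('r, 'm \<times> 'm) module" where
  "double_module M =
     \<lparr>carrier = carrier M \<times> carrier M, monoid.mult = undefined, monoid.one = undefined,
      ring.zero = (\<zero>\<^bsub>M\<^esub>, \<zero>\<^bsub>M\<^esub>),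
      ring.add = (\<lambda>p q. (fst p \<oplus>\<^bsub>M\<^esub> fst q, snd p \<oplus>\<^bsub>M\<^esub> snd q)),
      smult = (\<lambda>r p. (r \<odot>\<^bsub>M\<^esub> fst p, r \<odot>\<^bsub>M\<^esub> snd p))\<rparr>"

lemma left_module_double:
  assumes "left_module R M"
  shows "left_module R (double_module M)"
proof -
  interpret M: left_module R M by fact
  have "abelian_group (double_module M)"
    by (rule abelian_groupI)
      (auto simp: double_module_def M.M.add.m_ac intro: M.M.l_neg)
  moreover have "left_module_axioms R (double_module M)"
    by unfold_locales
      (auto simp: double_module_def M.smult_l_distr M.smult_r_distr M.smult_assoc1)
  ultimately show ?thesis using M.R.ring_axioms by (simp add: left_module_def)
qed

text \<open>An infinite type is equinumerous with its square, so \<open>M \<times> M\<close> has a copy in the universe of \<open>M\<close>.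
  The four structure maps and their relations are all that the additivity argument below needs
  from this copy.\<close>

lemma double_exists:
  fixes M :: "('r, 'm) module"
  assumes M: "left_module R M" and inf: "infinite (UNIV :: 'm set)"
  obtains D :: "('r, 'm) module" and \<iota>\<^sub>1 \<iota>\<^sub>2 \<pi>\<^sub>1 \<pi>\<^sub>2
  where "left_module R D"
    and "\<iota>\<^sub>1 \<in> mod_hom R M D" and "\<iota>\<^sub>2 \<in> mod_hom R M D"
    and "\<pi>\<^sub>1 \<in> mod_hom R D M" and "\<pi>\<^sub>2 \<in> mod_hom R D M"
    and "\<And>x. x \<in> carrier M \<Longrightarrow> \<pi>\<^sub>1 (\<iota>\<^sub>1 x) = x" and "\<And>x. x \<in> carrier M \<Longrightarrow> \<pi>\<^sub>1 (\<iota>\<^sub>2 x) = \<zero>\<^bsub>M\<^esub>"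
    and "\<And>x. x \<in> carrier M \<Longrightarrow> \<pi>\<^sub>2 (\<iota>\<^sub>1 x) = \<zero>\<^bsub>M\<^esub>" and "\<And>x. x \<in> carrier M \<Longrightarrow> \<pi>\<^sub>2 (\<iota>\<^sub>2 x) = x"
proof -
  interpret M: left_module R M by fact
  have "|UNIV :: ('m \<times> 'm) set| \<le>o |UNIV :: 'm set|"
    using card_of_Times_same_infinite[OF inf] by (simp add: ordIso_iff_ordLeq)
  then obtain j :: "'m \<times> 'm \<Rightarrow> 'm" where "inj j" using card_of_ordLeq[of UNIV UNIV] by auto
  then have j: "inj_on j (carrier (double_module M))" 
    and [simp]: "inv_into UNIV j (j p) = p" "j p = j q \<longleftrightarrow> p = q" for p q
    by (auto intro: inj_on_subset dest: injD)
  let ?D = "transport j (double_module M)"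
  note [simp] = transport_simps[OF j]
  have [simp]: "carrier (double_module M) = carrier M \<times> carrier M"
    "(x, y) \<oplus>\<^bsub>double_module M\<^esub> (x', y') = (x \<oplus>\<^bsub>M\<^esub> x', y \<oplus>\<^bsub>M\<^esub> y')"
    "r \<odot>\<^bsub>double_module M\<^esub> (x, y) = (r \<odot>\<^bsub>M\<^esub> x, r \<odot>\<^bsub>M\<^esub> y)" for x y x' y' r
    by (auto simp: double_module_def)
  note [simp] = left_module_smult_zero[OF M]
  show ?thesis
  proof
    show "left_module R ?D" by (rule left_module_transport[OF left_module_double[OF M] j])
    show "(\<lambda>x\<in>carrier M. j (x, \<zero>\<^bsub>M\<^esub>)) \<in> mod_hom R M ?D"
      and "(\<lambda>x\<in>carrier M. j (\<zero>\<^bsub>M\<^esub>, x)) \<in> mod_hom R M ?D"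
      and "(\<lambda>p\<in>carrier ?D. fst (inv_into UNIV j p)) \<in> mod_hom R ?D M"
      and "(\<lambda>p\<in>carrier ?D. snd (inv_into UNIV j p)) \<in> mod_hom R ?D M"
      by (rule mod_homI; auto)+
  qed auto
qed

section \<open>Extension of scalars and its universal property\<close>

locale scalar_extension =
  fixes R :: "'r ring" and S :: "'s ring" and \<phi> :: "'r \<Rightarrow> 's"
  assumes ring_R: "ring R" and ring_S: "ring S" and \<phi>: "\<phi> \<in> ring_hom R S"
begin

lemmas ring_hyps = ring_S \<phi>
lemmas tensor_module = tensor_left_module[OF ring_hyps]

abbreviation ext :: "('r, 'm) module \<Rightarrow> ('s, (('s \<times> 'm) \<Rightarrow>\<^sub>0 int) set) module"
  where "ext M \<equiv> tensor R S \<phi> M"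

abbreviation ext_map where "ext_map \<equiv> tensor_map R S \<phi>"

definition pure_tensor :: "('r, 'm) module \<Rightarrow> 's \<Rightarrow> 'm \<Rightarrow> (('s \<times> 'm) \<Rightarrow>\<^sub>0 int) set" where
  "pure_tensor M s m = tensor_kernel R S \<phi> M #>\<^bsub>tensor_free S M\<^esub> frag_of (s, m)"

lemma pure_tensor_closed:
  "s \<in> carrier S \<Longrightarrow> m \<in> carrier M \<Longrightarrow> pure_tensor M s m \<in> carrier (ext M)"
  by (auto simp: pure_tensor_def tensor_sel(1)[OF ring_hyps])

lemma coset_add:
  assumes "left_module R M" and "c \<in> carrier (tensor_free S M)" and "d \<in> carrier (tensor_free S M)"
  shows "(tensor_kernel R S \<phi> M #>\<^bsub>tensor_free S M\<^esub> c) \<oplus>\<^bsub>ext M\<^esub>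
      (tensor_kernel R S \<phi> M #>\<^bsub>tensor_free S M\<^esub> d) = tensor_kernel R S \<phi> M #>\<^bsub>tensor_free S M\<^esub> (c + d)"
  using normal.rcos_sum[OF tensor_kernel_normal[OF ring_hyps assms(1)] assms(2,3)]
  by (simp add: tensor_sel(3)[OF ring_hyps])

lemma coset_diff:
  assumes M: "left_module R M" and c: "c \<in> carrier (tensor_free S M)" and d: "d \<in> carrier (tensor_free S M)"
  shows "tensor_kernel R S \<phi> M #>\<^bsub>tensor_free S M\<^esub> (c - d) =
      (tensor_kernel R S \<phi> M #>\<^bsub>tensor_free S M\<^esub> c) \<ominus>\<^bsub>ext M\<^esub>
      (tensor_kernel R S \<phi> M #>\<^bsub>tensor_free S M\<^esub> d)"
    (is "?q (c - d) = ?q c \<ominus>\<^bsub>_\<^esub> ?q d")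
proof -
  interpret T: left_module S "ext M" by (rule tensor_module[OF M])
  have cl: "?q x \<in> carrier (ext M)" if "x \<in> carrier (tensor_free S M)" for x
    using that by (auto simp: tensor_sel(1)[OF ring_hyps])
  have cd: "c - d \<in> carrier (tensor_free S M)"
    using c d keys_diff[of c d] by auto
  have "?q (c - d) \<oplus>\<^bsub>ext M\<^esub> ?q d = ?q c"
    using coset_add[OF M cd d] by simp
  then show ?thesis
    using T.M.add.inv_solve_right[OF cl[OF cd] cl[OF c] cl[OF d]] by (simp add: a_minus_def)
qed

text \<open>The elements of \<open>S \<otimes>\<^sub>R M\<close> are cosets of elements of a free abelian group, and those arise from the
  generators by subtraction alone.\<close>

lemma ext_induct [consumes 2, case_names diff pure]:
  assumes M: "left_module R M" and x: "x \<in> carrier (ext M)"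
    and diff: "\<And>x y. x \<in> carrier (ext M) \<Longrightarrow> y \<in> carrier (ext M) \<Longrightarrow> P x \<Longrightarrow> P y \<Longrightarrow> P (x \<ominus>\<^bsub>ext M\<^esub> y)"
    and pure: "\<And>s m. s \<in> carrier S \<Longrightarrow> m \<in> carrier M \<Longrightarrow> P (pure_tensor M s m)"
  shows "P x"
proof -
  interpret M: left_module R M by fact
  interpret S: ring S by (rule ring_S)
  interpret T: left_module S "ext M" by (rule tensor_module[OF M])
  let ?q = "\<lambda>c. tensor_kernel R S \<phi> M #>\<^bsub>tensor_free S M\<^esub> c"
  have cl: "?q x \<in> carrier (ext M)" if "Poly_Mapping.keys x \<subseteq> carrier S \<times> carrier M" for x
    using that by (auto simp: tensor_sel(1)[OF ring_hyps])
  obtain c where c: "Poly_Mapping.keys c \<subseteq> carrier S \<times> carrier M" and x_eq: "x = ?q c"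
    using x by (auto simp: tensor_sel(1)[OF ring_hyps])
  have "Poly_Mapping.keys c \<subseteq> carrier S \<times> carrier M \<and> P (?q c)"
    using c
  proof (induction c rule: free_Abelian_induct)
    case zero
    \<comment> \<open>The zero element has to be reached from the hypotheses as a difference \<open>u - u\<close> with \<open>u\<close> pure.\<close>
    let ?u = "frag_of (\<zero>\<^bsub>S\<^esub>, \<zero>\<^bsub>M\<^esub>)"
    have u: "?u \<in> carrier (tensor_free S M)" by simp
    have "P (?q ?u)" using pure[of "\<zero>\<^bsub>S\<^esub>" "\<zero>\<^bsub>M\<^esub>"] by (simp add: pure_tensor_def)
    then have "P (?q ?u \<ominus>\<^bsub>ext M\<^esub> ?q ?u)" using diff u cl by simp
    then have "P (?q (?u - ?u))" using coset_diff[OF M u u] by simp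
    then show ?case by simp
  next
    case (diff c d)
    then have "Poly_Mapping.keys (c - d) \<subseteq> carrier S \<times> carrier M" using keys_diff[of c d] by auto
    then show ?case using diff coset_diff[OF M, of c d] assms(3)[OF cl cl, of c d] by simp
  next
    case (one p)
    then show ?case using pure by (cases p) (simp add: pure_tensor_def)
  qed
  then show ?thesis by (simp add: x_eq)
qed

lemma smult_pure_tensor:
  assumes "left_module R M" and "s \<in> carrier S" and "t \<in> carrier S" and "m \<in> carrier M"
  shows "s \<odot>\<^bsub>ext M\<^esub> pure_tensor M t m = pure_tensor M (s \<otimes>\<^bsub>S\<^esub> t) m"
  using tensor_smult[OF ring_hyps assms(1,2), of "frag_of (t, m)"] assms
  by (simp add: pure_tensor_def tensor_act_def[OF ring_hyps])

lemma pure_tensor_factor: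
  assumes "left_module R M" and "s \<in> carrier S" and "m \<in> carrier M"
  shows "pure_tensor M s m = s \<odot>\<^bsub>ext M\<^esub> pure_tensor M \<one>\<^bsub>S\<^esub> m"
proof -
  interpret S: ring S by (rule ring_S)
  show ?thesis using assms by (simp add: smult_pure_tensor)
qed

lemma coset_eq_of_relator:
  assumes M: "left_module R M" and "x - y \<in> tensor_relators R S \<phi> M"
    and "y \<in> carrier (tensor_free S M)"
  shows "tensor_kernel R S \<phi> M #>\<^bsub>tensor_free S M\<^esub> x = tensor_kernel R S \<phi> M #>\<^bsub>tensor_free S M\<^esub> y"
  using assms by (intro tensor_coset_eqI[OF ring_hyps M]) (auto simp: tensor_kernel_def intro: generate.incl)

lemma pure_tensor_add_right:
  assumes M: "left_module R M" and "s \<in> carrier S" and "m \<in> carrier M" and "n \<in> carrier M"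
  shows "pure_tensor M s (m \<oplus>\<^bsub>M\<^esub> n) = pure_tensor M s m \<oplus>\<^bsub>ext M\<^esub> pure_tensor M s n"
proof -
  have c: "frag_of (s, m) + frag_of (s, n) \<in> carrier (tensor_free S M)"
    using assms keys_add[of "frag_of (s, m)" "frag_of (s, n)"] by auto
  have "frag_of (s, m \<oplus>\<^bsub>M\<^esub> n) - (frag_of (s, m) + frag_of (s, n)) \<in> tensor_relators R S \<phi> M"
    using assms by (auto simp: tensor_relators_def diff_diff_eq)
  from coset_eq_of_relator[OF M this c] show ?thesis
    using assms by (simp add: pure_tensor_def coset_add)
qed

lemma pure_tensor_balanced:
  assumes M: "left_module R M" and "s \<in> carrier S" and "r \<in> carrier R" and "m \<in> carrier M"
  shows "pure_tensor M s (r \<odot>\<^bsub>M\<^esub> m) = pure_tensor M (s \<otimes>\<^bsub>S\<^esub> \<phi> r) m"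
  unfolding pure_tensor_def
  using assms left_module.smult_closed[OF M]
  by (intro coset_eq_of_relator[OF M, symmetric]) (auto simp: tensor_relators_def)

text \<open>The unit \<open>m \<mapsto> 1 \<otimes> m\<close> of the adjunction between extension and restriction of scalars; it is
  \<open>R\<close>-linear because \<open>1 \<otimes> r m = \<phi>(r) \<otimes> m = \<phi>(r) (1 \<otimes> m)\<close>.\<close>

lemma unit_mod_hom:
  assumes M: "left_module R M"
  shows "(\<lambda>m\<in>carrier M. pure_tensor M \<one>\<^bsub>S\<^esub> m) \<in> mod_hom R M (restrict_scalars \<phi> (ext M))"
proof -
  interpret S: ring S by (rule ring_S)
  interpret M: left_module R M by fact
  show ?thesis
    using ring_hom_closed[OF \<phi>] M
    by (intro mod_homI)
      (auto simp: pure_tensor_closed pure_tensor_add_right pure_tensor_balanced smult_pure_tensor)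
qed

lemma ext_map_pure_tensor:
  assumes "left_module R M" and "left_module R N" and "f \<in> mod_hom R M N"
    and "s \<in> carrier S" and "m \<in> carrier M"
  shows "ext_map M N f (pure_tensor M s m) = pure_tensor N s (f m)"
  using tensor_map_coset[OF ring_hyps assms(1-3), of "frag_of (s, m)"] assms(4,5)
  by (simp add: pure_tensor_def tensor_ind_def[OF ring_hyps])

lemmas ext_map_mod_hom = tensor_map_hom[OF ring_hyps]

text \<open>The elements \<open>1 \<otimes> m\<close> generate \<open>S \<otimes>\<^sub>R M\<close> as an \<open>S\<close>-module, since \<open>s \<otimes> m = s (1 \<otimes> m)\<close>.\<close>

lemma ext_hom_eqI:
  assumes M: "left_module R M" and N: "left_module S N"
    and f: "f \<in> mod_hom S (ext M) N" and g: "g \<in> mod_hom S (ext M) N"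
    and eq: "\<And>m. m \<in> carrier M \<Longrightarrow> f (pure_tensor M \<one>\<^bsub>S\<^esub> m) = g (pure_tensor M \<one>\<^bsub>S\<^esub> m)"
  shows "f = g"
proof (rule mod_hom_eqI[OF f g])
  interpret S: ring S by (rule ring_S)
  fix x assume x: "x \<in> carrier (ext M)"
  from M x show "f x = g x"
  proof (induction rule: ext_induct)
    case (diff x y)
    then show ?case
      using mod_hom_minus[OF tensor_module[OF M] N f] mod_hom_minus[OF tensor_module[OF M] N g] by simp
  next
    case (pure s m)
    then show ?case
      using mod_hom_smult[OF f] mod_hom_smult[OF g] eq
      by (simp add: pure_tensor_factor[OF M, of s m] pure_tensor_closed)
  qed
qed

text \<open>The assignment \<open>(s, m) \<mapsto> s f(m)\<close> extends to the free abelian group on \<open>S \<times> M\<close>.  The module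
  axioms for \<open>N\<close> and the linearity of \<open>f\<close> say precisely that the three kinds of relators are sent to
  \<open>0\<close>, so the extension factors through the tensor product.\<close>

lemma ext_universal:
  assumes M: "left_module R M" and N: "left_module S N"
    and f: "f \<in> mod_hom R M (restrict_scalars \<phi> N)"
  obtains g where "g \<in> mod_hom S (ext M) N"
    and "\<And>s m. s \<in> carrier S \<Longrightarrow> m \<in> carrier M \<Longrightarrow> g (pure_tensor M s m) = s \<odot>\<^bsub>N\<^esub> f m"
proof -
  interpret S: ring S by (rule ring_S)
  interpret M: left_module R M by fact
  interpret N: left_module S N by fact
  let ?G = "tensor_free S M" and ?K = "tensor_kernel R S \<phi> M" and ?A = "add_monoid N"
  have f_cl: "f m \<in> carrier N" if "m \<in> carrier M" for m using mod_hom_closed[OF f that] by simp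
  have f_add: "f (m \<oplus>\<^bsub>M\<^esub> n) = f m \<oplus>\<^bsub>N\<^esub> f n" if "m \<in> carrier M" "n \<in> carrier M" for m n
    using mod_hom_add[OF f that] by simp
  have f_smult: "f (r \<odot>\<^bsub>M\<^esub> m) = \<phi> r \<odot>\<^bsub>N\<^esub> f m" if "r \<in> carrier R" "m \<in> carrier M" for r m
    using mod_hom_smult[OF f that] by simp
  note \<phi>_cl = ring_hom_closed[OF \<phi>]
  have im: "(\<lambda>p. fst p \<odot>\<^bsub>N\<^esub> f (snd p)) ` (carrier S \<times> carrier M) \<subseteq> carrier ?A"
    using f_cl by auto
  obtain \<theta> where \<theta>: "\<theta> \<in> hom ?G ?A"
    and \<theta>_of: "\<And>p. p \<in> carrier S \<times> carrier M \<Longrightarrow> \<theta> (frag_of p) = fst p \<odot>\<^bsub>N\<^esub> f (snd p)"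
    using comm_group.free_Abelian_group_universal[OF N.M.a_comm_group im] by blast
  interpret \<theta>: group_hom ?G ?A \<theta>
    using \<theta> N.M.a_group by (simp add: group_hom_def group_hom_axioms_def)
  have \<theta>_diff: "\<theta> (c - d) = \<theta> c \<ominus>\<^bsub>N\<^esub> \<theta> d" if "c \<in> carrier ?G" "d \<in> carrier ?G" for c d
  proof -
    have "c - d = c \<otimes>\<^bsub>?G\<^esub> inv\<^bsub>?G\<^esub> d" using that by simp
    also have "\<theta> \<dots> = \<theta> c \<otimes>\<^bsub>?A\<^esub> inv\<^bsub>?A\<^esub> \<theta> d"
      by (simp only: \<theta>.hom_mult \<theta>.hom_inv \<theta>.G.inv_closed that)
    finally show ?thesis by (simp add: a_minus_def a_inv_def)
  qed
  have diff_cl: "c - d \<in> carrier ?G" if "c \<in> carrier ?G" "d \<in> carrier ?G" for c d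
    using that keys_diff[of c d] by auto
  have cancel: "(x \<oplus>\<^bsub>N\<^esub> y) \<ominus>\<^bsub>N\<^esub> x \<ominus>\<^bsub>N\<^esub> y = \<zero>\<^bsub>N\<^esub>"
    if "x \<in> carrier N" "y \<in> carrier N" for x y
    using that N.M.add.m_comm[of x y] by (simp add: a_minus_def N.M.add.m_assoc N.M.r_neg)
  have rel: "\<theta> x = \<zero>\<^bsub>N\<^esub>" if "x \<in> tensor_relators R S \<phi> M" for x
    using that unfolding tensor_relators_def
  proof (elim UnE CollectE exE conjE, goal_cases)
    case (1 s t m)
    then have "\<theta> x = (s \<oplus>\<^bsub>S\<^esub> t) \<odot>\<^bsub>N\<^esub> f m \<ominus>\<^bsub>N\<^esub> s \<odot>\<^bsub>N\<^esub> f m \<ominus>\<^bsub>N\<^esub> t \<odot>\<^bsub>N\<^esub> f m"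
      by (simp add: \<theta>_diff diff_cl \<theta>_of del: carrier_free_Abelian_group_iff)
    then show ?case using 1 f_cl
      by (simp add: N.smult_l_distr cancel)
  next
    case (2 s m n)
    then have "\<theta> x = s \<odot>\<^bsub>N\<^esub> f (m \<oplus>\<^bsub>M\<^esub> n) \<ominus>\<^bsub>N\<^esub> s \<odot>\<^bsub>N\<^esub> f m \<ominus>\<^bsub>N\<^esub> s \<odot>\<^bsub>N\<^esub> f n"
      by (simp add: \<theta>_diff diff_cl \<theta>_of del: carrier_free_Abelian_group_iff)
    then show ?case using 2 f_cl
      by (simp add: f_add N.smult_r_distr cancel)
  next
    case (3 s r m)
    then have "\<theta> x = (s \<otimes>\<^bsub>S\<^esub> \<phi> r) \<odot>\<^bsub>N\<^esub> f m \<ominus>\<^bsub>N\<^esub> s \<odot>\<^bsub>N\<^esub> f (r \<odot>\<^bsub>M\<^esub> m)"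
      by (simp add: \<theta>_diff diff_cl \<theta>_of \<phi>_cl del: carrier_free_Abelian_group_iff)
    then show ?case using 3 f_cl
      by (simp add: f_smult N.smult_assoc1 \<phi>_cl a_minus_def N.M.r_neg)
  qed
  have "tensor_relators R S \<phi> M \<subseteq> kernel ?G ?A \<theta>"
    using rel tensor_relators_carrier[OF ring_hyps M]
    by (auto simp: kernel_def simp del: carrier_free_Abelian_group_iff)
  then have K: "?K \<subseteq> kernel ?G ?A \<theta>"
    unfolding tensor_kernel_def
    by (rule group.generate_subgroup_incl[OF group_free_Abelian_group _ \<theta>.subgroup_kernel])
  obtain g\<^sub>0 where g\<^sub>0: "\<And>c. c \<in> carrier ?G \<Longrightarrow> g\<^sub>0 (?K #>\<^bsub>?G\<^esub> c) = \<theta> c"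
    using \<theta>.FactGroup_universal_kernel[OF tensor_kernel_normal[OF ring_hyps M] K] by blast
  define g where "g = restrict g\<^sub>0 (carrier (ext M))"
  have q_cl: "?K #>\<^bsub>?G\<^esub> c \<in> carrier (ext M)" if "c \<in> carrier ?G" for c
    using that by (auto simp: tensor_sel(1)[OF ring_hyps])
  have g: "g (?K #>\<^bsub>?G\<^esub> c) = \<theta> c" if "c \<in> carrier ?G" for c
    using g\<^sub>0[OF that] q_cl[OF that] by (simp add: g_def)
  have ex: "\<exists>c\<in>carrier ?G. x = ?K #>\<^bsub>?G\<^esub> c" if "x \<in> carrier (ext M)" for x
    using that by (auto simp: tensor_sel(1)[OF ring_hyps])
  have act_cl: "tensor_act S s c \<in> carrier ?G" if "s \<in> carrier S" "c \<in> carrier ?G" for s c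
    using hom_in_carrier[OF tensor_act_hom[OF ring_hyps that(1)] that(2)] .
  have \<theta>_act: "\<theta> (tensor_act S s c) = s \<odot>\<^bsub>N\<^esub> \<theta> c" if s: "s \<in> carrier S" and c: "c \<in> carrier ?G" for s c
  proof -
    have "c \<in> carrier ?G \<and> \<theta> (tensor_act S s c) = s \<odot>\<^bsub>N\<^esub> \<theta> c"
      using c[unfolded carrier_free_Abelian_group_iff]
    proof (induction c rule: free_Abelian_induct)
      case zero
      then show ?case using \<theta>.hom_one s left_module_smult_zero[OF N s]
        by (simp add: tensor_act_def[OF ring_hyps])
    next
      case (diff c d)
      have "tensor_act S s (c - d) = tensor_act S s c - tensor_act S s d"
        by (simp add: tensor_act_def[OF ring_hyps] frag_extend_diff)
      moreover have "s \<odot>\<^bsub>N\<^esub> (\<theta> c \<ominus>\<^bsub>N\<^esub> \<theta> d) = s \<odot>\<^bsub>N\<^esub> \<theta> c \<ominus>\<^bsub>N\<^esub> s \<odot>\<^bsub>N\<^esub> \<theta> d"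
        using diff s \<theta>.hom_closed by (simp add: left_module_smult_minus[OF N s])
      ultimately show ?case using diff s
        by (simp add: \<theta>_diff diff_cl act_cl del: carrier_free_Abelian_group_iff)
    next
      case (one p)
      then show ?case
        using s f_cl by (auto simp: tensor_act_def[OF ring_hyps] \<theta>_of N.smult_assoc1)
    qed
    then show ?thesis ..
  qed
  show ?thesis
  proof
    show "g \<in> mod_hom S (ext M) N"
    proof (rule mod_homI)
      show "g x \<in> carrier N" if "x \<in> carrier (ext M)" for x
        using ex[OF that] g \<theta>.hom_closed by auto
      show "g \<in> extensional (carrier (ext M))" by (simp add: g_def)
      show "g (x \<oplus>\<^bsub>ext M\<^esub> y) = g x \<oplus>\<^bsub>N\<^esub> g y" if x: "x \<in> carrier (ext M)" and y: "y \<in> carrier (ext M)" for x y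
      proof -
        obtain c d where c: "c \<in> carrier ?G" "x = ?K #>\<^bsub>?G\<^esub> c" and d: "d \<in> carrier ?G" "y = ?K #>\<^bsub>?G\<^esub> d"
          using ex[OF x] ex[OF y] by blast
        have "c + d \<in> carrier ?G" using c(1) d(1) \<theta>.G.m_closed[of c d] by simp
        then show ?thesis using c d \<theta>.hom_mult[of c d]
          by (simp add: coset_add[OF M] g del: carrier_free_Abelian_group_iff)
      qed
      show "g (s \<odot>\<^bsub>ext M\<^esub> x) = s \<odot>\<^bsub>N\<^esub> g x" if "s \<in> carrier S" "x \<in> carrier (ext M)" for s x
        using ex[OF that(2)] that(1)
        by (auto simp add: tensor_smult[OF ring_hyps M] g act_cl \<theta>_act simp del: carrier_free_Abelian_group_iff)
    qed
    show "g (pure_tensor M s m) = s \<odot>\<^bsub>N\<^esub> f m" if "s \<in> carrier S" "m \<in> carrier M" for s m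
      using that by (simp add: pure_tensor_def g \<theta>_of)
  qed
qed

section \<open>A retraction yields heavy separability\<close>

text \<open>Restriction along \<open>\<phi>\<close> undoes restriction along \<open>E\<close>, because \<open>E \<circ> \<phi>\<close> is the identity.  The identity of
  \<open>M\<close> is therefore \<open>R\<close>-linear from \<open>M\<close> to the restriction along \<open>\<phi>\<close> of the \<open>S\<close>-module obtained from \<open>M\<close>
  along \<open>E\<close>, and the universal property turns it into an \<open>S\<close>-linear map \<open>s \<otimes> m \<mapsto> E(s) m\<close>.\<close>

lemma retraction_counit:
  assumes E: "E \<in> ring_hom S R" and retr: "\<And>r. r \<in> carrier R \<Longrightarrow> E (\<phi> r) = r"
    and M: "left_module R M"
  obtains \<epsilon> where "\<epsilon> \<in> mod_hom S (ext M) (restrict_scalars E M)"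
    and "\<And>m. m \<in> carrier M \<Longrightarrow> \<epsilon> (pure_tensor M \<one>\<^bsub>S\<^esub> m) = m"
proof -
  interpret S: ring S by (rule ring_S)
  interpret M: left_module R M by fact
  have M_E: "left_module S (restrict_scalars E M)"
    by (rule left_module_restrict_scalars[OF ring_S E M])
  have "(\<lambda>m\<in>carrier M. m) \<in> mod_hom R M (restrict_scalars \<phi> (restrict_scalars E M))"
    by (rule mod_homI) (auto simp: retr)
  then obtain \<epsilon> where "\<epsilon> \<in> mod_hom S (ext M) (restrict_scalars E M)"
    and \<epsilon>: "\<And>s m. s \<in> carrier S \<Longrightarrow> m \<in> carrier M \<Longrightarrow>
      \<epsilon> (pure_tensor M s m) = s \<odot>\<^bsub>restrict_scalars E M\<^esub> (\<lambda>m\<in>carrier M. m) m"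
    using ext_universal[OF M M_E] by blast
  with that show ?thesis using ring_hom_one[OF E] by simp
qed

text \<open>Put \<open>P(h) = \<epsilon> \<circ> h \<circ> \<eta>\<close> with \<open>\<eta>(x) = 1 \<otimes> x\<close> and \<open>\<epsilon>(s \<otimes> y) = E(s) y\<close>.  The decisive identity is
  \<open>P(h) \<circ> \<epsilon> = \<epsilon> \<circ> h\<close> for every \<open>S\<close>-linear \<open>h\<close>, whether or not \<open>h\<close> is induced from an \<open>R\<close>-linear map.
  It gives \<open>P(f) \<circ> P(g) = P(f) \<circ> \<epsilon> \<circ> g \<circ> \<eta> = \<epsilon> \<circ> f \<circ> g \<circ> \<eta> = P(f \<circ> g)\<close>; naturality is then a
  special case of multiplicativity, as \<open>P\<close> sends an induced map back to the map inducing it.\<close>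

lemma retraction_imp_h_separable:
  assumes E: "E \<in> ring_hom S R" and retr: "\<And>r. r \<in> carrier R \<Longrightarrow> E (\<phi> r) = r"
  shows "h_separable (left_Mod R) (left_Mod S)
    (induction_functor R S \<phi> ::
       (('r, 'm) module, 'm \<Rightarrow> 'm,
        ('s, (('s \<times> 'm) \<Rightarrow>\<^sub>0 int) set) module,
        (('s \<times> 'm) \<Rightarrow>\<^sub>0 int) set \<Rightarrow> (('s \<times> 'm) \<Rightarrow>\<^sub>0 int) set) funct)"
proof -
  interpret S: ring S by (rule ring_S)
  define \<epsilon> where "\<epsilon> M = (SOME \<epsilon>. \<epsilon> \<in> mod_hom S (ext M) (restrict_scalars E M) \<and>
      (\<forall>m\<in>carrier M. \<epsilon> (pure_tensor M \<one>\<^bsub>S\<^esub> m) = m))" for M :: "('r, 'm) module"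
  have "\<epsilon> M \<in> mod_hom S (ext M) (restrict_scalars E M) \<and>
      (\<forall>m\<in>carrier M. \<epsilon> M (pure_tensor M \<one>\<^bsub>S\<^esub> m) = m)"
    if "left_module R M" for M :: "('r, 'm) module"
  proof -
    have "\<exists>\<epsilon>. \<epsilon> \<in> mod_hom S (ext M) (restrict_scalars E M) \<and>
        (\<forall>m\<in>carrier M. \<epsilon> (pure_tensor M \<one>\<^bsub>S\<^esub> m) = m)"
      by (rule retraction_counit[OF E retr that]) blast+
    from someI_ex[OF this] show ?thesis unfolding \<epsilon>_def .
  qed
  then have \<epsilon>: "\<epsilon> M \<in> mod_hom S (ext M) (restrict_scalars E M)"
    and \<epsilon>_unit: "m \<in> carrier M \<Longrightarrow> \<epsilon> M (pure_tensor M \<one>\<^bsub>S\<^esub> m) = m"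
    if "left_module R M" for M :: "('r, 'm) module" and m
    using that by blast+
  have restr: "left_module S (restrict_scalars E M)" if "left_module R M" for M :: "('r, 'm) module"
    by (rule left_module_restrict_scalars[OF ring_S E that])
  have \<epsilon>_cl: "\<epsilon> M x \<in> carrier M" if "left_module R M" "x \<in> carrier (ext M)" for M :: "('r, 'm) module" and x
    using mod_hom_closed[OF \<epsilon>[OF that(1)] that(2)] by simp
  define P where "P X Y h = (\<lambda>x\<in>carrier X. \<epsilon> Y (h (pure_tensor X \<one>\<^bsub>S\<^esub> x)))"
    for X Y :: "('r, 'm) module" and h
  have unit_cl: "pure_tensor X \<one>\<^bsub>S\<^esub> x \<in> carrier (ext X)" if "x \<in> carrier X" for X :: "('r, 'm) module" and x
    using that by (simp add: pure_tensor_closed)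
  have P: "P X Y h \<in> mod_hom R X Y"
    if X: "left_module R X" and Y: "left_module R Y" and h: "h \<in> mod_hom S (ext X) (ext Y)"
    for X Y :: "('r, 'm) module" and h
  proof -
    note unit = unit_mod_hom[OF X]
    show ?thesis
    proof (rule mod_homI)
      show "P X Y h x \<in> carrier Y" if "x \<in> carrier X" for x
        using that Y by (simp add: P_def \<epsilon>_cl mod_hom_closed[OF h] unit_cl)
      show "P X Y h \<in> extensional (carrier X)" by (simp add: P_def)
      show "P X Y h (x \<oplus>\<^bsub>X\<^esub> y) = P X Y h x \<oplus>\<^bsub>Y\<^esub> P X Y h y"
        if "x \<in> carrier X" "y \<in> carrier X" for x y
        using that mod_hom_add[OF \<epsilon>[OF Y]]
        by (simp add: P_def left_module_add_closed[OF X] pure_tensor_add_right[OF X]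
            mod_hom_add[OF h] mod_hom_closed[OF h] unit_cl)
      show "P X Y h (r \<odot>\<^bsub>X\<^esub> x) = r \<odot>\<^bsub>Y\<^esub> P X Y h x" if "r \<in> carrier R" "x \<in> carrier X" for r x
        using that mod_hom_smult[OF unit that] mod_hom_smult[OF \<epsilon>[OF Y]] ring_hom_closed[OF \<phi>]
        by (simp add: P_def left_module.smult_closed[OF X] mod_hom_smult[OF h] mod_hom_closed[OF h]
            unit_cl retr)
    qed
  qed
  \<comment> \<open>Both sides are \<open>S\<close>-linear when \<open>S\<close> acts on \<open>Y\<close> through \<open>E\<close>,
    so that it is enough to compare them on \<open>1 \<otimes> x\<close>, where \<open>\<epsilon>\<close> returns \<open>x\<close>.\<close>
  have key: "P X Y h (\<epsilon> X z) = \<epsilon> Y (h z)"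
    if X: "left_module R X" and Y: "left_module R Y" and h: "h \<in> mod_hom S (ext X) (ext Y)"
      and z: "z \<in> carrier (ext X)"
    for X Y :: "('r, 'm) module" and h z
  proof -
    have "compose (carrier (ext X)) (P X Y h) (\<epsilon> X) = compose (carrier (ext X)) (\<epsilon> Y) h"
    proof (rule ext_hom_eqI[OF X restr[OF Y]])
      show "compose (carrier (ext X)) (P X Y h) (\<epsilon> X) \<in> mod_hom S (ext X) (restrict_scalars E Y)"
        by (rule compose_mod_hom[OF tensor_module[OF X] restr[OF X] restr[OF Y] \<epsilon>[OF X]
              mod_hom_restrict_scalars[OF P[OF X Y h] E]])
      show "compose (carrier (ext X)) (\<epsilon> Y) h \<in> mod_hom S (ext X) (restrict_scalars E Y)"
        by (rule compose_mod_hom[OF tensor_module[OF X] tensor_module[OF Y] restr[OF Y] h \<epsilon>[OF Y]])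
    qed (simp add: compose_def unit_cl \<epsilon>_unit[OF X] P_def)
    from fun_cong[OF this, of z] z show ?thesis by (simp add: compose_def)
  qed
  have P_ext_map: "P X Y (ext_map X Y f) = f"
    if X: "left_module R X" and Y: "left_module R Y" and f: "f \<in> mod_hom R X Y"
    for X Y :: "('r, 'm) module" and f
    by (rule mod_hom_eqI[OF P[OF X Y ext_map_mod_hom[OF X Y f]] f])
      (simp add: P_def ext_map_pure_tensor[OF X Y f] mod_hom_closed[OF f] \<epsilon>_unit[OF Y])
  have P_comp: "P X Z (compose (carrier (ext X)) f g) = compose (carrier X) (P Y Z f) (P X Y g)"
    if X: "left_module R X" and Y: "left_module R Y" and Z: "left_module R Z"
      and g: "g \<in> mod_hom S (ext X) (ext Y)" and f: "f \<in> mod_hom S (ext Y) (ext Z)"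
    for X Y Z :: "('r, 'm) module" and f g
  proof
    fix x
    show "P X Z (compose (carrier (ext X)) f g) x = compose (carrier X) (P Y Z f) (P X Y g) x"
      using key[OF Y Z f, of "g (pure_tensor X \<one>\<^bsub>S\<^esub> x)"] mod_hom_closed[OF g unit_cl, of x]
      by (cases "x \<in> carrier X") (simp_all add: compose_def P_def[of X] unit_cl)
  qed
  have P_nat: "P X' Y' (compose (carrier (ext X')) (ext_map Y Y' v)
        (compose (carrier (ext X')) h (ext_map X' X u))) =
      compose (carrier X') v (compose (carrier X') (P X Y h) u)"
    if X: "left_module R X" and Y: "left_module R Y" and X': "left_module R X'" and Y': "left_module R Y'"
      and u: "u \<in> mod_hom R X' X" and v: "v \<in> mod_hom R Y Y'" and h: "h \<in> mod_hom S (ext X) (ext Y)"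
    for X Y X' Y' :: "('r, 'm) module" and u v h
  proof -
    note Fu = ext_map_mod_hom[OF X' X u] and Fv = ext_map_mod_hom[OF Y Y' v]
    have hu: "compose (carrier (ext X')) h (ext_map X' X u) \<in> mod_hom S (ext X') (ext Y)"
      by (rule compose_mod_hom[OF tensor_module[OF X'] tensor_module[OF X] tensor_module[OF Y] Fu h])
    show ?thesis
      by (simp only: P_comp[OF X' Y Y' hu Fv] P_comp[OF X' X Y Fu h] P_ext_map[OF X' X u] P_ext_map[OF Y Y' v])
  qed
  show ?thesis
    unfolding h_separable_def
  proof (intro exI[of _ P] conjI ballI, goal_cases)
    case (1 X Y h)
    then show ?case using P by (simp add: left_Mod_def induction_functor_def)
  next
    case (2 X Y X' Y' u v h)
    then show ?case using P_nat[of X Y X' Y' u v h] by (simp add: left_Mod_def induction_functor_def)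
  next
    case (3 X Y f)
    then show ?case using P_ext_map[of X Y f] by (simp add: left_Mod_def induction_functor_def)
  next
    case (4 X Y Z g f)
    then show ?case using P_comp[of X Y Z g f] by (simp add: left_Mod_def induction_functor_def)
  qed
qed

section \<open>Heavy separability yields a retraction\<close>

lemma ext_map_id:
  fixes M :: "('r, 'm) module"
  assumes "left_module R M"
  shows "ext_map M M (\<lambda>x\<in>carrier M. x) = (\<lambda>x\<in>carrier (ext M). x)"
proof -
  have "is_functor (left_Mod R) (left_Mod S)
      (induction_functor R S \<phi> :: (('r, 'm) module, 'm \<Rightarrow> 'm, _, _) funct)"
    by (rule is_functor_induction[OF ring_hyps])
  then show ?thesis
    using assms by (simp add: is_functor_def left_Mod_def induction_functor_def)
qed

lemma ext_map_inverse:
  assumes M: "left_module R M" and N: "left_module R N"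
    and f: "f \<in> mod_hom R M N" and g: "g \<in> mod_hom R N M"
    and inv: "\<And>m. m \<in> carrier M \<Longrightarrow> g (f m) = m" and x: "x \<in> carrier (ext M)"
  shows "ext_map N M g (ext_map M N f x) = x"
proof -
  interpret S: ring S by (rule ring_S)
  note FM = tensor_module[OF M] and FN = tensor_module[OF N]
  have "compose (carrier (ext M)) (ext_map N M g) (ext_map M N f) = (\<lambda>x\<in>carrier (ext M). x)"
    by (rule ext_hom_eqI[OF M FM compose_mod_hom[OF FM FN FM ext_map_mod_hom[OF M N f]
          ext_map_mod_hom[OF N M g]] id_mod_hom[OF FM]])
      (simp add: compose_def pure_tensor_closed ext_map_pure_tensor[OF M N f]
        ext_map_pure_tensor[OF N M g] mod_hom_closed[OF f] inv)
  from fun_cong[OF this, of x] x show ?thesis by (simp add: compose_def)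
qed

lemma ext_map_annihilate:
  assumes M: "left_module R M" and N: "left_module R N" and L: "left_module R L"
    and f: "f \<in> mod_hom R M N" and g: "g \<in> mod_hom R N L"
    and zero: "\<And>m. m \<in> carrier M \<Longrightarrow> g (f m) = \<zero>\<^bsub>L\<^esub>" and x: "x \<in> carrier (ext M)"
  shows "ext_map N L g (ext_map M N f x) = \<zero>\<^bsub>ext L\<^esub>"
proof -
  interpret S: ring S by (rule ring_S)
  note FM = tensor_module[OF M] and FN = tensor_module[OF N] and FL = tensor_module[OF L]
  have "pure_tensor L \<one>\<^bsub>S\<^esub> \<zero>\<^bsub>L\<^esub> = \<zero>\<^bsub>ext L\<^esub>"
    using mod_hom_zero[OF L left_module_restrict_scalars[OF ring_R \<phi> FL] unit_mod_hom[OF L]]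
    by (simp add: left_module_zero_closed[OF L])
  then have "compose (carrier (ext M)) (ext_map N L g) (ext_map M N f) = (\<lambda>x\<in>carrier (ext M). \<zero>\<^bsub>ext L\<^esub>)"
    by (intro ext_hom_eqI[OF M FL compose_mod_hom[OF FM FN FL ext_map_mod_hom[OF M N f]
          ext_map_mod_hom[OF N L g]] zero_mod_hom[OF FM FL]])
      (simp add: compose_def pure_tensor_closed ext_map_pure_tensor[OF M N f]
        ext_map_pure_tensor[OF N L g] mod_hom_closed[OF f] zero)
  from fun_cong[OF this, of x] x show ?thesis by (simp add: compose_def)
qed

text \<open>Additivity is forced by naturality in the target alone.  Given \<open>h\<close> and \<open>k\<close>, let
  \<open>w = F \<iota>\<^sub>1 \<circ> h + F \<iota>\<^sub>2 \<circ> k\<close>, a map into \<open>F (Y \<oplus> Y)\<close> where \<open>F\<close> is extension of scalars.  Composing \<open>w\<close> with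
  \<open>F \<pi>\<^sub>1\<close>, \<open>F \<pi>\<^sub>2\<close> and \<open>F (\<pi>\<^sub>1 + \<pi>\<^sub>2)\<close> gives \<open>h\<close>, \<open>k\<close> and \<open>h + k\<close>.  Hence \<open>Q\<close> sends these three maps to the
  composites of the single map \<open>Q(w)\<close> with \<open>\<pi>\<^sub>1\<close>, \<open>\<pi>\<^sub>2\<close> and \<open>\<pi>\<^sub>1 + \<pi>\<^sub>2\<close>.\<close>

lemma natural_imp_additive:
  fixes X Y :: "('r, 'm) module"
  assumes inf: "infinite (UNIV :: 'm set)"
    and X: "left_module R X" and Y: "left_module R Y"
    and Q: "\<And>Y h. left_module R Y \<Longrightarrow> h \<in> mod_hom S (ext X) (ext Y) \<Longrightarrow> Q Y h \<in> mod_hom R X Y"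
    and nat: "\<And>Y Z h v. left_module R Y \<Longrightarrow> left_module R Z \<Longrightarrow>
      h \<in> mod_hom S (ext X) (ext Y) \<Longrightarrow> v \<in> mod_hom R Y Z \<Longrightarrow>
      Q Z (compose (carrier (ext X)) (ext_map Y Z v) h) = compose (carrier X) v (Q Y h)"
    and h: "h \<in> mod_hom S (ext X) (ext Y)" and k: "k \<in> mod_hom S (ext X) (ext Y)"
  shows "Q Y (hom_sum (ext X) (ext Y) h k) = hom_sum X Y (Q Y h) (Q Y k)"
proof -
  note FX = tensor_module[OF X] and FY = tensor_module[OF Y]
  interpret FY: left_module S "ext Y" by (rule FY)
  obtain D :: "('r, 'm) module" and \<iota>\<^sub>1 \<iota>\<^sub>2 \<pi>\<^sub>1 \<pi>\<^sub>2 where D: "left_module R D"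
    and \<iota>\<^sub>1: "\<iota>\<^sub>1 \<in> mod_hom R Y D" and \<iota>\<^sub>2: "\<iota>\<^sub>2 \<in> mod_hom R Y D"
    and \<pi>\<^sub>1: "\<pi>\<^sub>1 \<in> mod_hom R D Y" and \<pi>\<^sub>2: "\<pi>\<^sub>2 \<in> mod_hom R D Y"
    and 11: "\<And>y. y \<in> carrier Y \<Longrightarrow> \<pi>\<^sub>1 (\<iota>\<^sub>1 y) = y" and 12: "\<And>y. y \<in> carrier Y \<Longrightarrow> \<pi>\<^sub>1 (\<iota>\<^sub>2 y) = \<zero>\<^bsub>Y\<^esub>"
    and 21: "\<And>y. y \<in> carrier Y \<Longrightarrow> \<pi>\<^sub>2 (\<iota>\<^sub>1 y) = \<zero>\<^bsub>Y\<^esub>" and 22: "\<And>y. y \<in> carrier Y \<Longrightarrow> \<pi>\<^sub>2 (\<iota>\<^sub>2 y) = y"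
    using double_exists[OF Y inf] by blast
  interpret Y: left_module R Y by (rule Y)
  note FD = tensor_module[OF D]
  let ?codiag = "hom_sum D Y \<pi>\<^sub>1 \<pi>\<^sub>2"
  have codiag: "?codiag \<in> mod_hom R D Y" by (rule hom_sum_mod_hom[OF D Y \<pi>\<^sub>1 \<pi>\<^sub>2])
  have codiag1: "?codiag (\<iota>\<^sub>1 y) = y" and codiag2: "?codiag (\<iota>\<^sub>2 y) = y" if "y \<in> carrier Y" for y
    using that by (simp_all add: hom_sum_def mod_hom_closed[OF \<iota>\<^sub>1] mod_hom_closed[OF \<iota>\<^sub>2] 11 12 21 22)
  define w where "w = hom_sum (ext X) (ext D)
    (compose (carrier (ext X)) (ext_map Y D \<iota>\<^sub>1) h) (compose (carrier (ext X)) (ext_map Y D \<iota>\<^sub>2) k)"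
  have w: "w \<in> mod_hom S (ext X) (ext D)"
    unfolding w_def
    by (rule hom_sum_mod_hom[OF FX FD compose_mod_hom[OF FX FY FD h ext_map_mod_hom[OF Y D \<iota>\<^sub>1]]
          compose_mod_hom[OF FX FY FD k ext_map_mod_hom[OF Y D \<iota>\<^sub>2]]])
  have Fv_w: "ext_map D Y v (w x) =
      ext_map D Y v (ext_map Y D \<iota>\<^sub>1 (h x)) \<oplus>\<^bsub>ext Y\<^esub> ext_map D Y v (ext_map Y D \<iota>\<^sub>2 (k x))"
    if v: "v \<in> mod_hom R D Y" and x: "x \<in> carrier (ext X)" for v x
    using x mod_hom_add[OF ext_map_mod_hom[OF D Y v]]
      mod_hom_closed[OF ext_map_mod_hom[OF Y D \<iota>\<^sub>1]] mod_hom_closed[OF ext_map_mod_hom[OF Y D \<iota>\<^sub>2]]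
    by (simp add: w_def hom_sum_def compose_def mod_hom_closed[OF h] mod_hom_closed[OF k])
  note cancel = ext_map_inverse[OF Y D] and annihilate = ext_map_annihilate[OF Y D Y]
  note hk_cl = mod_hom_closed[OF h] mod_hom_closed[OF k]
  have "compose (carrier (ext X)) (ext_map D Y \<pi>\<^sub>1) w = h"
    by (rule mod_hom_eqI[OF compose_mod_hom[OF FX FD FY w ext_map_mod_hom[OF D Y \<pi>\<^sub>1]] h])
      (simp add: compose_def Fv_w[OF \<pi>\<^sub>1] hk_cl cancel[OF \<iota>\<^sub>1 \<pi>\<^sub>1 11] annihilate[OF \<iota>\<^sub>2 \<pi>\<^sub>1 12])
  then have Qh: "Q Y h = compose (carrier X) \<pi>\<^sub>1 (Q D w)" using nat[OF D Y w \<pi>\<^sub>1] by simp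
  have "compose (carrier (ext X)) (ext_map D Y \<pi>\<^sub>2) w = k"
    by (rule mod_hom_eqI[OF compose_mod_hom[OF FX FD FY w ext_map_mod_hom[OF D Y \<pi>\<^sub>2]] k])
      (simp add: compose_def Fv_w[OF \<pi>\<^sub>2] hk_cl cancel[OF \<iota>\<^sub>2 \<pi>\<^sub>2 22] annihilate[OF \<iota>\<^sub>1 \<pi>\<^sub>2 21])
  then have Qk: "Q Y k = compose (carrier X) \<pi>\<^sub>2 (Q D w)" using nat[OF D Y w \<pi>\<^sub>2] by simp
  have "compose (carrier (ext X)) (ext_map D Y ?codiag) w = hom_sum (ext X) (ext Y) h k"
    by (rule mod_hom_eqI[OF compose_mod_hom[OF FX FD FY w ext_map_mod_hom[OF D Y codiag]]
          hom_sum_mod_hom[OF FX FY h k]])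
      (simp add: compose_def Fv_w[OF codiag] hk_cl cancel[OF \<iota>\<^sub>1 codiag codiag1] cancel[OF \<iota>\<^sub>2 codiag codiag2] hom_sum_def[of "ext X"])
  then have "Q Y (hom_sum (ext X) (ext Y) h k) = compose (carrier X) ?codiag (Q D w)"
    using nat[OF D Y w codiag] by simp
  also have "\<dots> = hom_sum X Y (Q Y h) (Q Y k)"
    using mod_hom_closed[OF Q[OF D w]] by (auto simp: Qh Qk hom_sum_def compose_def fun_eq_iff)
  finally show ?thesis .
qed

text \<open>Together with the uniqueness statement that follows, this says that \<open>1 \<otimes> e\<close> is a basis of
  \<open>S \<otimes>\<^sub>R M\<close> over \<open>S\<close> when \<open>e\<close> is a basis of \<open>M\<close>.\<close>

lemma ext_basis_extend:
  assumes M: "module_basis R M e" and N: "left_module S N" and n: "n \<in> carrier N"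
  obtains f where "f \<in> mod_hom S (ext M) N" and "f (pure_tensor M \<one>\<^bsub>S\<^esub> e) = n"
proof -
  interpret S: ring S by (rule ring_S)
  have M': "left_module R M" and e: "e \<in> carrier M" using M by (auto simp: module_basis_def)
  obtain f where f: "f \<in> mod_hom R M (restrict_scalars \<phi> N)" "f e = n"
    using module_basis_extend[OF M left_module_restrict_scalars[OF ring_R \<phi> N]] n by auto
  obtain g where g: "g \<in> mod_hom S (ext M) N"
    and "\<And>s m. s \<in> carrier S \<Longrightarrow> m \<in> carrier M \<Longrightarrow> g (pure_tensor M s m) = s \<odot>\<^bsub>N\<^esub> f m"
    using ext_universal[OF M' N f(1)] by blast
  then have "g (pure_tensor M \<one>\<^bsub>S\<^esub> e) = n"
    using e n f(2) left_module.smult_one[OF N] by simp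
  with g show ?thesis by (rule that)
qed

lemma ext_basis_eqI:
  assumes M: "module_basis R M e" and N: "left_module S N"
    and f: "f \<in> mod_hom S (ext M) N" and g: "g \<in> mod_hom S (ext M) N"
    and eq: "f (pure_tensor M \<one>\<^bsub>S\<^esub> e) = g (pure_tensor M \<one>\<^bsub>S\<^esub> e)"
  shows "f = g"
proof -
  interpret S: ring S by (rule ring_S)
  have M': "left_module R M" and e: "e \<in> carrier M"
    and surj: "(\<lambda>r. r \<odot>\<^bsub>M\<^esub> e) ` carrier R = carrier M"
    using M by (auto simp: module_basis_def bij_betw_def)
  show ?thesis
  proof (rule ext_hom_eqI[OF M' N f g])
    fix m assume "m \<in> carrier M"
    then obtain r where r: "r \<in> carrier R" "m = r \<odot>\<^bsub>M\<^esub> e" using surj by blast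
    then have "pure_tensor M \<one>\<^bsub>S\<^esub> m = \<phi> r \<odot>\<^bsub>ext M\<^esub> pure_tensor M \<one>\<^bsub>S\<^esub> e"
      using mod_hom_smult[OF unit_mod_hom[OF M'], of r e] e left_module.smult_closed[OF M'] by simp
    then show "f (pure_tensor M \<one>\<^bsub>S\<^esub> m) = g (pure_tensor M \<one>\<^bsub>S\<^esub> m)"
      using r(1) e eq ring_hom_closed[OF \<phi>]
      by (simp add: mod_hom_smult[OF f] mod_hom_smult[OF g] pure_tensor_closed)
  qed
qed

text \<open>Let \<open>e\<close> be a basis of a free module \<open>M\<close> of rank one.  An endomorphism of \<open>S \<otimes>\<^sub>R M\<close> is
  determined by an element \<open>s\<close> of \<open>S\<close>, through \<open>h\<^sub>s(1 \<otimes> e) = s (1 \<otimes> e)\<close>, and an endomorphism of \<open>M\<close> by the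
  coordinate of the image of \<open>e\<close>.  In these terms \<open>P\<close> becomes a map \<open>E\<close> from \<open>S\<close> to \<open>R\<close>.  On both sides
  composition is multiplication in the reverse order, so \<open>E\<close> is multiplicative; it is additive
  because \<open>P\<close> is natural, and it retracts \<open>\<phi>\<close> because \<open>h\<^sub>s\<close> for \<open>s = \<phi>(r)\<close> is induced by \<open>e \<mapsto> r e\<close>.\<close>

lemma h_separable_imp_retraction:
  assumes inf: "infinite (UNIV :: 'm set)" and room: "carrier R \<lesssim> (UNIV :: 'm set)"
    and sep: "h_separable (left_Mod R) (left_Mod S)
      (induction_functor R S \<phi> ::
         (('r, 'm) module, 'm \<Rightarrow> 'm,
          ('s, (('s \<times> 'm) \<Rightarrow>\<^sub>0 int) set) module,
          (('s \<times> 'm) \<Rightarrow>\<^sub>0 int) set \<Rightarrow> (('s \<times> 'm) \<Rightarrow>\<^sub>0 int) set) funct)"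
  shows "\<exists>E \<in> ring_hom S R. \<forall>r \<in> carrier R. E (\<phi> r) = r"
proof -
  interpret R: ring R by (rule ring_R)
  interpret S: ring S by (rule ring_S)
  obtain P :: "('r, 'm) module \<Rightarrow> ('r, 'm) module \<Rightarrow>
      ((('s \<times> 'm) \<Rightarrow>\<^sub>0 int) set \<Rightarrow> (('s \<times> 'm) \<Rightarrow>\<^sub>0 int) set) \<Rightarrow> 'm \<Rightarrow> 'm"
    where P: "\<And>X Y h. left_module R X \<Longrightarrow> left_module R Y \<Longrightarrow> h \<in> mod_hom S (ext X) (ext Y) \<Longrightarrow>
        P X Y h \<in> mod_hom R X Y"
    and P_nat: "\<And>X Y X' Y' u v h. left_module R X \<Longrightarrow> left_module R Y \<Longrightarrow>
        left_module R X' \<Longrightarrow> left_module R Y' \<Longrightarrow>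
        u \<in> mod_hom R X' X \<Longrightarrow> v \<in> mod_hom R Y Y' \<Longrightarrow> h \<in> mod_hom S (ext X) (ext Y) \<Longrightarrow>
        P X' Y' (compose (carrier (ext X')) (ext_map Y Y' v)
          (compose (carrier (ext X')) h (ext_map X' X u))) =
        compose (carrier X') v (compose (carrier X') (P X Y h) u)"
    and P_ext_map: "\<And>X Y f. left_module R X \<Longrightarrow> left_module R Y \<Longrightarrow> f \<in> mod_hom R X Y \<Longrightarrow>
        P X Y (ext_map X Y f) = f"
    and P_comp: "\<And>X Y Z f g. left_module R X \<Longrightarrow> left_module R Y \<Longrightarrow> left_module R Z \<Longrightarrow>
        g \<in> mod_hom S (ext X) (ext Y) \<Longrightarrow> f \<in> mod_hom S (ext Y) (ext Z) \<Longrightarrow>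
        P X Z (compose (carrier (ext X)) f g) = compose (carrier X) (P Y Z f) (P X Y g)"
    using sep unfolding h_separable_def
  proof (simp add: left_Mod_def induction_functor_def, elim exE conjE, goal_cases)
    case (1 P)
    show ?case by (rule 1(1)[of P]) (simp_all add: 1(2-))
  qed
  obtain M :: "('r, 'm) module" and e where basis: "module_basis R M e"
    using module_basis_exists[OF ring_R room] .
  then have M: "left_module R M" and e: "e \<in> carrier M"
    and bij: "bij_betw (\<lambda>r. r \<odot>\<^bsub>M\<^esub> e) (carrier R) (carrier M)"
    by (auto simp: module_basis_def)
  interpret M: left_module R M by (rule M)
  note FM = tensor_module[OF M]
  interpret FM: left_module S "ext M" by (rule FM)
  let ?u = "pure_tensor M \<one>\<^bsub>S\<^esub> e"
  have u: "?u \<in> carrier (ext M)" using e by (simp add: pure_tensor_closed)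
  have "\<exists>h. h \<in> mod_hom S (ext M) (ext M) \<and> h ?u = s \<odot>\<^bsub>ext M\<^esub> ?u" if "s \<in> carrier S" for s
    by (rule ext_basis_extend[OF basis FM FM.smult_closed[OF that u]]) blast
  then have "\<forall>s\<in>carrier S. \<exists>h. h \<in> mod_hom S (ext M) (ext M) \<and> h ?u = s \<odot>\<^bsub>ext M\<^esub> ?u" ..
  from bchoice[OF this] obtain h where h: "\<And>s. s \<in> carrier S \<Longrightarrow> h s \<in> mod_hom S (ext M) (ext M)"
    and h_u: "\<And>s. s \<in> carrier S \<Longrightarrow> h s ?u = s \<odot>\<^bsub>ext M\<^esub> ?u"
    by blast
  have h_eqI: "h s = f" if "s \<in> carrier S" "f \<in> mod_hom S (ext M) (ext M)" "f ?u = s \<odot>\<^bsub>ext M\<^esub> ?u" for s f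
    using that by (intro ext_basis_eqI[OF basis FM]) (auto simp: h h_u)
  note Ph = P[OF M M h]
  define E where "E s = inv_into (carrier R) (\<lambda>r. r \<odot>\<^bsub>M\<^esub> e) (P M M (h s) e)" for s
  have "P M M (h s) e \<in> (\<lambda>r. r \<odot>\<^bsub>M\<^esub> e) ` carrier R" if "s \<in> carrier S" for s
    using bij_betw_imp_surj_on[OF bij] mod_hom_closed[OF Ph[OF that] e] by simp
  from inv_into_into[OF this] f_inv_into_f[OF this]
  have E_cl: "E s \<in> carrier R" and E_e: "E s \<odot>\<^bsub>M\<^esub> e = P M M (h s) e" if "s \<in> carrier S" for s
    using that by (simp_all add: E_def)
  have E_eqI: "E s = r" if "s \<in> carrier S" "r \<in> carrier R" "P M M (h s) e = r \<odot>\<^bsub>M\<^esub> e" for s r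
    using inj_onD[OF bij_betw_imp_inj_on[OF bij], of "E s" r] that E_cl[of s] E_e[of s] by simp
  have E_\<phi>: "E (\<phi> r) = r" if r: "r \<in> carrier R" for r
  proof (rule E_eqI[OF ring_hom_closed[OF \<phi> r] r])
    obtain f where f: "f \<in> mod_hom R M M" "f e = r \<odot>\<^bsub>M\<^esub> e"
      using module_basis_extend[OF basis M, of "r \<odot>\<^bsub>M\<^esub> e"] r e by auto
    have "ext_map M M f ?u = \<phi> r \<odot>\<^bsub>ext M\<^esub> ?u"
      using r e f mod_hom_smult[OF unit_mod_hom[OF M], of r e]
      by (simp add: ext_map_pure_tensor[OF M M])
    then have "h (\<phi> r) = ext_map M M f"
      by (intro h_eqI ring_hom_closed[OF \<phi> r] ext_map_mod_hom[OF M M f(1)])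
    then show "P M M (h (\<phi> r)) e = r \<odot>\<^bsub>M\<^esub> e" using P_ext_map[OF M M f(1)] f(2) by simp
  qed
  have "E \<in> ring_hom S R"
  proof (rule ring_hom_memI)
    show "E s \<in> carrier R" if "s \<in> carrier S" for s by (rule E_cl[OF that])
    show "E (s \<otimes>\<^bsub>S\<^esub> t) = E s \<otimes>\<^bsub>R\<^esub> E t" if s: "s \<in> carrier S" and t: "t \<in> carrier S" for s t
    proof (rule E_eqI)
      \<comment> \<open>\<open>h\<^sub>t(h\<^sub>s(u)) = h\<^sub>t(s u) = s h\<^sub>t(u) = s t u\<close>: linearity reverses the order of the factors.\<close>
      have "h (s \<otimes>\<^bsub>S\<^esub> t) = compose (carrier (ext M)) (h t) (h s)"
        using s t u
        by (intro h_eqI compose_mod_hom[OF FM FM FM] h)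
          (auto simp: compose_def h_u mod_hom_smult[OF h] FM.smult_assoc1)
      then have "P M M (h (s \<otimes>\<^bsub>S\<^esub> t)) e = P M M (h t) (P M M (h s) e)"
        using P_comp[OF M M M h[OF s] h[OF t]] e by (simp add: compose_def)
      also have "\<dots> = (E s \<otimes>\<^bsub>R\<^esub> E t) \<odot>\<^bsub>M\<^esub> e"
        using mod_hom_smult[OF Ph[OF t] E_cl[OF s] e] s t e
        by (simp add: E_e[symmetric] E_cl M.smult_assoc1)
      finally show "P M M (h (s \<otimes>\<^bsub>S\<^esub> t)) e = (E s \<otimes>\<^bsub>R\<^esub> E t) \<odot>\<^bsub>M\<^esub> e" .
    qed (use s t E_cl in auto)
    show "E (s \<oplus>\<^bsub>S\<^esub> t) = E s \<oplus>\<^bsub>R\<^esub> E t" if s: "s \<in> carrier S" and t: "t \<in> carrier S" for s t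
    proof (rule E_eqI)
      \<comment> \<open>Precomposing with the identity reduces two-sided naturality to naturality in the target.\<close>
      have nat: "P M Z (compose (carrier (ext M)) (ext_map Y Z v) f) = compose (carrier M) v (P M Y f)"
        if Y: "left_module R Y" and Z: "left_module R Z"
          and f: "f \<in> mod_hom S (ext M) (ext Y)" and v: "v \<in> mod_hom R Y Z"
        for Y Z :: "('r, 'm) module" and f v
        using P_nat[OF M Y M Z id_mod_hom[OF M] v f]
        by (simp add: ext_map_id[OF M] compose_id_mod_hom[OF f] compose_id_mod_hom[OF P[OF M Y f]])
      have "h (s \<oplus>\<^bsub>S\<^esub> t) = hom_sum (ext M) (ext M) (h s) (h t)"
        using s t u
        by (intro h_eqI hom_sum_mod_hom[OF FM FM] h) (auto simp: hom_sum_def h_u FM.smult_l_distr)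
      then have "P M M (h (s \<oplus>\<^bsub>S\<^esub> t)) = hom_sum M M (P M M (h s)) (P M M (h t))"
        using natural_imp_additive[where Q = "P M", OF inf M M P[OF M] nat h[OF s] h[OF t]] by simp
      then show "P M M (h (s \<oplus>\<^bsub>S\<^esub> t)) e = (E s \<oplus>\<^bsub>R\<^esub> E t) \<odot>\<^bsub>M\<^esub> e"
        using s t e by (simp add: hom_sum_def E_e[symmetric] E_cl M.smult_l_distr)
    qed (use s t E_cl in auto)
    show "E \<one>\<^bsub>S\<^esub> = \<one>\<^bsub>R\<^esub>" using E_\<phi>[of "\<one>\<^bsub>R\<^esub>"] ring_hom_one[OF \<phi>] by simp
  qed
  with E_\<phi> show ?thesis by blast
qed

end

theorem proposition3p1:
  fixes R :: "'r ring" and S :: "'s ring" and \<phi> :: "'r \<Rightarrow> 's"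
  assumes "ring R" and "ring S" and "\<phi> \<in> ring_hom R S"
    and "infinite (UNIV :: 'm set)" and "carrier R \<lesssim> (UNIV :: 'm set)"
  shows "h_separable (left_Mod R) (left_Mod S)
           (induction_functor R S \<phi> ::
             (('r, 'm) module, 'm \<Rightarrow> 'm,
              ('s, (('s \<times> 'm) \<Rightarrow>\<^sub>0 int) set) module,
              (('s \<times> 'm) \<Rightarrow>\<^sub>0 int) set \<Rightarrow> (('s \<times> 'm) \<Rightarrow>\<^sub>0 int) set) funct) \<longleftrightarrow>
         (\<exists>E \<in> ring_hom S R. \<forall>r \<in> carrier R. E (\<phi> r) = r)"
proof -
  interpret scalar_extension R S \<phi> by (rule scalar_extension.intro) fact+
  show ?thesis
    using h_separable_imp_retraction[OF assms(4,5)] retraction_imp_h_separable by blast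
qed

end
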